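(* Let $(M,\Delta,g_c)$ be a sub-Riemannian manifold with $\Delta$ of rank $k$, and let $\widetilde\Delta$ be a smooth distribution complementary to $\Delta$, so that $TM=\Delta\oplus\widetilde\Delta$. For a vector field $X$ let $X^{\mathcal{H}}$ be its projection to $\Delta$ with respect to this direct sum decomposition. Let $\{X_1,\dots,X_k\}$ be a (local) $g_c$-orthonormal basis of $\Delta$ and define $D$ by $$D_UV=\sum_{i=1}^kU(V^i)X_i+\sum_{i=1}^k\sum_{j=1}^k\sum_{l=1}^kU^jV^i\,\Gamma_{ij}^l\,X_l\quad\text{for } U=\sum_{j=1}^kU^jX_j,\ V=\sum_{i=1}^kV^iX_i\in\Gamma(\Delta),$$ where $$\Gamma_{ij}^l=-\tfrac12\Big\{g_c\big(X_i,[X_j,X_l]^{\mathcal{H}}\big)-g_c\big(X_j,[X_l,X_i]^{\mathcal{H}}\big)+g_c\big(X_l,[X_i,X_j]^{\mathcal{H}}\big)\Big\}.$$ Then $D$ is independent of the choice of the orthonormal basis of $\Delta$ (so it is a well-defined map $\Gamma(\Delta)\times\Gamma(\Delta)\to\Gamma(\Delta)$), and it is the unique map $\Gamma(\Delta)\times\Gamma(\Delta)\to\Gamma(\Delta)$ satisfying: 1. $D_UV$ is $\mathbb{R}$-linear in both arguments; 2. $D_UV$ is $C^\infty(M)$-linear in the argument $U$; 3. $D_U(fV)=(Uf)V+fD_UV$ for all $f\in C^\infty(M)$, $U,V\in\Gamma(\Delta)$; 4. $U g_c(V,W)=g_c(D_UV,W)+g_c(V,D_UW)$ for all $U,V,W\in\Gamma(\Delta)$;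 5. $D_UV-D_VU=[U,V]^{\mathcal{H}}$ for all $U,V\in\Gamma(\Delta)$. In particular $D=\widetilde D$, where $\widetilde D$ is the horizontal connection obtained from any orthogonal extension $g$ of $g_c$ for which $\Delta$ and $\widetilde\Delta$ are $g$-orthogonal.
   Context: A sub-Riemannian manifold $(M,\Delta,g_c)$ is a smooth manifold $M$ of dimension $m$ with a smooth distribution (subbundle of $TM$) $\Delta$ of rank $k<m$ endowed with a smooth fiberwise inner product $g_c$. $\Gamma(\Delta)$ denotes the smooth sections of $\Delta$. An orthogonal extension of $g_c$ (relative to $\widetilde\Delta$) is a Riemannian metric $g$ on $M$ whose restriction to $\Delta$ is $g_c$ and for which $TM=\Delta\oplus\widetilde\Delta$ is a $g$-orthogonal decomposition. With $\nabla$ the Levi-Civita connection of $g$, the horizontal connection is $\widetilde D_XY=\sum_{i=1}^kg(\nabla_XY,X_i)X_i$ for $X,Y\in\Gamma(\Delta)$, where $\{X_1,\dots,X_k\}$ is any local $g_c$-orthonormal basis of $\Delta$ (i.e. $\widetilde D_XY$ is the $g$-orthogonal projection of $\nabla_XY$ to $\Delta$). *)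

theory Defs
  imports "HOL-Analysis.Analysis" "HOL-Library.Function_Algebras"
begin

(* Pointwise scaling; tangent vectors and vector fields below are functions, so sums and scalar
   multiples of both are the pointwise ones and span / independent apply to tangent vectors. *)

instantiation "fun" :: (type, real_vector) real_vector
begin

definition scaleR_fun_def: "r *\<^sub>R f = (\<lambda>x. r *\<^sub>R f x)"

instance
  by standard (auto simp: scaleR_fun_def plus_fun_def scaleR_add_left scaleR_add_right)

end


section \<open>Smooth manifolds\<close>

(* For open S and a finite-dimensional domain this is membership in the class C^n on S. *)

primrec Ck_on :: "nat \<Rightarrow> 'e::real_normed_vector set \<Rightarrow> ('e \<Rightarrow> 'f::real_normed_vector) \<Rightarrow> bool" where
  "Ck_on 0 S f \<longleftrightarrow> continuous_on S f"
| "Ck_on (Suc n) S f \<longleftrightarrow>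
     (\<forall>x\<in>S. f differentiable (at x)) \<and> (\<forall>v. Ck_on n S (\<lambda>x. frechet_derivative f (at x) v))"

definition smooth_on :: "'e::real_normed_vector set \<Rightarrow> ('e \<Rightarrow> 'f::real_normed_vector) \<Rightarrow> bool" where
  "smooth_on S f \<longleftrightarrow> (\<forall>n. Ck_on n S f)"

(* A chart is a pair of its domain and its coordinate map. *)

type_synonym ('a, 'e) atlas = "('a set \<times> ('a \<Rightarrow> 'e)) set"

(* The manifold is the whole type 'a, which is Hausdorff and second countable by its sort;
   its dimension is DIM('e). *)

definition smooth_atlas ::
  "('a::{t2_space, second_countable_topology}, 'e::euclidean_space) atlas \<Rightarrow> bool" where
  "smooth_atlas A \<longleftrightarrow>
     (\<forall>(W, \<phi>)\<in>A. open W \<and> open (\<phi> ` W) \<and> homeomorphism W (\<phi> ` W) \<phi> (inv_into W \<phi>)) \<and>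
     (\<Union>(W, \<phi>)\<in>A. W) = UNIV \<and>
     (\<forall>(W, \<phi>)\<in>A. \<forall>(W', \<phi>')\<in>A. smooth_on (\<phi> ` (W \<inter> W')) (\<phi>' \<circ> inv_into W \<phi>))"

(* Smooth functions on an open set S; C^\<infinity>(M) is the case S = UNIV. *)

definition smooth_fun_on ::
  "('a::topological_space, 'e::euclidean_space) atlas \<Rightarrow> 'a set \<Rightarrow> ('a \<Rightarrow> real) \<Rightarrow> bool" where
  "smooth_fun_on A S f \<longleftrightarrow> (\<forall>(W, \<phi>)\<in>A. smooth_on (\<phi> ` (S \<inter> W)) (f \<circ> inv_into W \<phi>))"

definition smooth_near ::
  "('a::topological_space, 'e::euclidean_space) atlas \<Rightarrow> 'a \<Rightarrow> ('a \<Rightarrow> real) \<Rightarrow> bool" where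
  "smooth_near A p f \<longleftrightarrow> (\<exists>S. open S \<and> p \<in> S \<and> smooth_fun_on A S f)"


section \<open>Tangent vectors and vector fields\<close>

(* A tangent vector at p is a derivation on germs at p of smooth functions.  The last clause only
   fixes the value on functions that have no smooth germ at p, so that a derivation is represented
   by exactly one function. *)

type_synonym 'a tvec = "('a \<Rightarrow> real) \<Rightarrow> real"

definition tangent_space ::
  "('a::topological_space, 'e::euclidean_space) atlas \<Rightarrow> 'a \<Rightarrow> 'a tvec set" where
  "tangent_space A p = {v.
     (\<forall>f g. smooth_near A p f \<longrightarrow> smooth_near A p g \<longrightarrow> v (\<lambda>q. f q + g q) = v f + v g) \<and>
     (\<forall>c f. smooth_near A p f \<longrightarrow> v (\<lambda>q. c * f q) = c * v f) \<and>
     (\<forall>f g. smooth_near A p f \<longrightarrow> smooth_near A p g \<longrightarrow>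
        v (\<lambda>q. f q * g q) = f p * v g + g p * v f) \<and>
     (\<forall>f g. smooth_near A p f \<longrightarrow> eventually (\<lambda>q. f q = g q) (nhds p) \<longrightarrow> v f = v g) \<and>
     (\<forall>f. \<not> smooth_near A p f \<longrightarrow> v f = 0)}"

type_synonym 'a vfield = "'a \<Rightarrow> 'a tvec"

(* Smooth vector fields on an open set S.  Values outside S are irrelevant. *)

definition vector_field_on ::
  "('a::topological_space, 'e::euclidean_space) atlas \<Rightarrow> 'a set \<Rightarrow> 'a vfield \<Rightarrow> bool" where
  "vector_field_on A S X \<longleftrightarrow>
     (\<forall>p\<in>S. X p \<in> tangent_space A p) \<and>
     (\<forall>W f. open W \<longrightarrow> W \<subseteq> S \<longrightarrow> smooth_fun_on A W f \<longrightarrow> smooth_fun_on A W (\<lambda>p. X p f))"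

definition fun_scale :: "('a \<Rightarrow> real) \<Rightarrow> 'a vfield \<Rightarrow> 'a vfield" where
  "fun_scale f X = (\<lambda>p. f p *\<^sub>R X p)"

(* The value at p only involves the germs of X and Y at p, so this also serves for vector fields
   defined near p only. *)

definition lie_bracket ::
  "('a::topological_space, 'e::euclidean_space) atlas \<Rightarrow> 'a vfield \<Rightarrow> 'a vfield \<Rightarrow> 'a vfield" where
  "lie_bracket A X Y = (\<lambda>p f.
     if smooth_near A p f then X p (\<lambda>q. Y q f) - Y p (\<lambda>q. X q f) else 0)"


section \<open>Distributions and metrics\<close>

definition sections ::
  "('a::topological_space, 'e::euclidean_space) atlas \<Rightarrow> ('a \<Rightarrow> 'a tvec set) \<Rightarrow> 'a set
     \<Rightarrow> 'a vfield set" where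
  "sections A E S = {X. vector_field_on A S X \<and> (\<forall>p\<in>S. X p \<in> E p)}"

abbreviation global_sections ("\<Gamma>") where
  "\<Gamma> A E \<equiv> sections A E UNIV"

definition distribution ::
  "('a::topological_space, 'e::euclidean_space) atlas \<Rightarrow> nat \<Rightarrow> ('a \<Rightarrow> 'a tvec set) \<Rightarrow> bool" where
  "distribution A k E \<longleftrightarrow>
     (\<forall>p. \<exists>S X. open S \<and> p \<in> S \<and> (\<forall>i<k. vector_field_on A S (X i)) \<and>
        (\<forall>q\<in>S. inj_on (\<lambda>i. X i q) {..<k} \<and> independent ((\<lambda>i. X i q) ` {..<k}) \<and>
               span ((\<lambda>i. X i q) ` {..<k}) = E q))"

definition fiber_metric ::
  "('a::topological_space, 'e::euclidean_space) atlas \<Rightarrow> ('a \<Rightarrow> 'a tvec set)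
     \<Rightarrow> ('a \<Rightarrow> 'a tvec \<Rightarrow> 'a tvec \<Rightarrow> real) \<Rightarrow> bool" where
  "fiber_metric A E g \<longleftrightarrow>
     (\<forall>p. \<forall>u\<in>E p. \<forall>v\<in>E p. \<forall>w\<in>E p. g p (u + v) w = g p u w + g p v w) \<and>
     (\<forall>p. \<forall>c. \<forall>u\<in>E p. \<forall>w\<in>E p. g p (c *\<^sub>R u) w = c * g p u w) \<and>
     (\<forall>p. \<forall>u\<in>E p. \<forall>w\<in>E p. g p u w = g p w u) \<and>
     (\<forall>p. \<forall>u\<in>E p. u \<noteq> 0 \<longrightarrow> 0 < g p u u) \<and>
     (\<forall>S. open S \<longrightarrow> (\<forall>X\<in>sections A E S. \<forall>Y\<in>sections A E S.
        smooth_fun_on A S (\<lambda>p. g p (X p) (Y p))))"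

definition sub_riemannian ::
  "('a::{t2_space, second_countable_topology}, 'e::euclidean_space) atlas \<Rightarrow> nat
     \<Rightarrow> ('a \<Rightarrow> 'a tvec set) \<Rightarrow> ('a \<Rightarrow> 'a tvec \<Rightarrow> 'a tvec \<Rightarrow> real) \<Rightarrow> bool" where
  "sub_riemannian A k E gc \<longleftrightarrow>
     smooth_atlas A \<and> k < DIM('e) \<and> distribution A k E \<and> fiber_metric A E gc"

definition complementary ::
  "('a::topological_space, 'e::euclidean_space) atlas \<Rightarrow> ('a \<Rightarrow> 'a tvec set)
     \<Rightarrow> ('a \<Rightarrow> 'a tvec set) \<Rightarrow> bool" where
  "complementary A E F \<longleftrightarrow>
     (\<forall>p. E p \<inter> F p = {0} \<and> {u + w | u w. u \<in> E p \<and> w \<in> F p} = tangent_space A p)"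

(* The projection to E along F. *)

definition hproj ::
  "('a \<Rightarrow> 'a tvec set) \<Rightarrow> ('a \<Rightarrow> 'a tvec set) \<Rightarrow> 'a vfield \<Rightarrow> 'a vfield" where
  "hproj E F X = (\<lambda>p. THE u. u \<in> E p \<and> (\<exists>w\<in>F p. X p = u + w))"

definition orthonormal_frame ::
  "('a::topological_space, 'e::euclidean_space) atlas \<Rightarrow> nat \<Rightarrow> ('a \<Rightarrow> 'a tvec set)
     \<Rightarrow> ('a \<Rightarrow> 'a tvec \<Rightarrow> 'a tvec \<Rightarrow> real) \<Rightarrow> 'a set \<Rightarrow> (nat \<Rightarrow> 'a vfield) \<Rightarrow> bool" where
  "orthonormal_frame A k E gc S X \<longleftrightarrow>
     open S \<and> (\<forall>i<k. X i \<in> sections A E S) \<and>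
     (\<forall>p\<in>S. span ((\<lambda>i. X i p) ` {..<k}) = E p \<and>
        (\<forall>i<k. \<forall>j<k. gc p (X i p) (X j p) = (if i = j then 1 else 0)))"

(* The coefficients V^i of V with respect to X_0, ..., X_(k-1). *)

definition coeff :: "nat \<Rightarrow> (nat \<Rightarrow> 'a vfield) \<Rightarrow> 'a vfield \<Rightarrow> nat \<Rightarrow> 'a \<Rightarrow> real" where
  "coeff k X V i p =
     (THE c :: nat \<Rightarrow> real. (\<forall>j\<ge>k. c j = 0) \<and> V p = (\<Sum>j<k. c j *\<^sub>R X j p)) i"


section \<open>The connection D\<close>

definition christoffel ::
  "('a::topological_space, 'e::euclidean_space) atlas \<Rightarrow> ('a \<Rightarrow> 'a tvec set)
     \<Rightarrow> ('a \<Rightarrow> 'a tvec set) \<Rightarrow> ('a \<Rightarrow> 'a tvec \<Rightarrow> 'a tvec \<Rightarrow> real) \<Rightarrow> (nat \<Rightarrow> 'a vfield)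
     \<Rightarrow> nat \<Rightarrow> nat \<Rightarrow> nat \<Rightarrow> 'a \<Rightarrow> real" where
  "christoffel A E F gc X i j l p = - (1 / 2) *
     (gc p (X i p) (hproj E F (lie_bracket A (X j) (X l)) p)
      - gc p (X j p) (hproj E F (lie_bracket A (X l) (X i)) p)
      + gc p (X l p) (hproj E F (lie_bracket A (X i) (X j)) p))"

definition frame_connection ::
  "('a::topological_space, 'e::euclidean_space) atlas \<Rightarrow> nat \<Rightarrow> ('a \<Rightarrow> 'a tvec set)
     \<Rightarrow> ('a \<Rightarrow> 'a tvec set) \<Rightarrow> ('a \<Rightarrow> 'a tvec \<Rightarrow> 'a tvec \<Rightarrow> real) \<Rightarrow> (nat \<Rightarrow> 'a vfield)
     \<Rightarrow> 'a vfield \<Rightarrow> 'a vfield \<Rightarrow> 'a vfield" where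
  "frame_connection A k E F gc X U V = (\<lambda>p.
     (\<Sum>i<k. U p (coeff k X V i) *\<^sub>R X i p) +
     (\<Sum>i<k. \<Sum>j<k. \<Sum>l<k.
        (coeff k X U j p * coeff k X V i p * christoffel A E F gc X i j l p) *\<^sub>R X l p))"

(* Meaningful once the values of frame_connection at p are known to agree for all orthonormal
   frames around p, and such frames to exist. *)

definition sr_connection ::
  "('a::topological_space, 'e::euclidean_space) atlas \<Rightarrow> nat \<Rightarrow> ('a \<Rightarrow> 'a tvec set)
     \<Rightarrow> ('a \<Rightarrow> 'a tvec set) \<Rightarrow> ('a \<Rightarrow> 'a tvec \<Rightarrow> 'a tvec \<Rightarrow> real)
     \<Rightarrow> 'a vfield \<Rightarrow> 'a vfield \<Rightarrow> 'a vfield" where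
  "sr_connection A k E F gc U V = (\<lambda>p. THE w.
     \<exists>S X. orthonormal_frame A k E gc S X \<and> p \<in> S \<and> w = frame_connection A k E F gc X U V p)"

(* Metric connections on the bundle E whose torsion-freeness is measured by the bracket br.
   With E = tangent_space A and br = lie_bracket A these are the defining properties of the
   Levi-Civita connection. *)

definition metric_torsion_free_connection ::
  "('a::topological_space, 'e::euclidean_space) atlas \<Rightarrow> ('a \<Rightarrow> 'a tvec set)
     \<Rightarrow> ('a \<Rightarrow> 'a tvec \<Rightarrow> 'a tvec \<Rightarrow> real) \<Rightarrow> ('a vfield \<Rightarrow> 'a vfield \<Rightarrow> 'a vfield)
     \<Rightarrow> ('a vfield \<Rightarrow> 'a vfield \<Rightarrow> 'a vfield) \<Rightarrow> bool" where
  "metric_torsion_free_connection A E g br D \<longleftrightarrow>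
     (\<forall>U\<in>\<Gamma> A E. \<forall>V\<in>\<Gamma> A E. D U V \<in> \<Gamma> A E) \<and>
     (\<forall>U\<in>\<Gamma> A E. \<forall>U'\<in>\<Gamma> A E. \<forall>V\<in>\<Gamma> A E. D (U + U') V = D U V + D U' V) \<and>
     (\<forall>c. \<forall>U\<in>\<Gamma> A E. \<forall>V\<in>\<Gamma> A E. D (c *\<^sub>R U) V = c *\<^sub>R D U V) \<and>
     (\<forall>U\<in>\<Gamma> A E. \<forall>V\<in>\<Gamma> A E. \<forall>V'\<in>\<Gamma> A E. D U (V + V') = D U V + D U V') \<and>
     (\<forall>c. \<forall>U\<in>\<Gamma> A E. \<forall>V\<in>\<Gamma> A E. D U (c *\<^sub>R V) = c *\<^sub>R D U V) \<and>
     (\<forall>f. smooth_fun_on A UNIV f \<longrightarrow> (\<forall>U\<in>\<Gamma> A E. \<forall>V\<in>\<Gamma> A E.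
        D (fun_scale f U) V = fun_scale f (D U V))) \<and>
     (\<forall>f. smooth_fun_on A UNIV f \<longrightarrow> (\<forall>U\<in>\<Gamma> A E. \<forall>V\<in>\<Gamma> A E.
        D U (fun_scale f V) = fun_scale (\<lambda>p. U p f) V + fun_scale f (D U V))) \<and>
     (\<forall>U\<in>\<Gamma> A E. \<forall>V\<in>\<Gamma> A E. \<forall>W\<in>\<Gamma> A E. \<forall>p.
        U p (\<lambda>q. g q (V q) (W q)) = g p (D U V p) (W p) + g p (V p) (D U W p)) \<and>
     (\<forall>U\<in>\<Gamma> A E. \<forall>V\<in>\<Gamma> A E. D U V - D V U = br U V)"

definition levi_civita ::
  "('a::topological_space, 'e::euclidean_space) atlas \<Rightarrow> ('a \<Rightarrow> 'a tvec \<Rightarrow> 'a tvec \<Rightarrow> real)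
     \<Rightarrow> ('a vfield \<Rightarrow> 'a vfield \<Rightarrow> 'a vfield) \<Rightarrow> bool" where
  "levi_civita A g nabla \<longleftrightarrow>
     metric_torsion_free_connection A (tangent_space A) g (lie_bracket A) nabla"

definition orthogonal_extension ::
  "('a::topological_space, 'e::euclidean_space) atlas \<Rightarrow> ('a \<Rightarrow> 'a tvec set)
     \<Rightarrow> ('a \<Rightarrow> 'a tvec set) \<Rightarrow> ('a \<Rightarrow> 'a tvec \<Rightarrow> 'a tvec \<Rightarrow> real)
     \<Rightarrow> ('a \<Rightarrow> 'a tvec \<Rightarrow> 'a tvec \<Rightarrow> real) \<Rightarrow> bool" where
  "orthogonal_extension A E F gc g \<longleftrightarrow>
     fiber_metric A (tangent_space A) g \<and>
     (\<forall>p. \<forall>u\<in>E p. \<forall>v\<in>E p. g p u v = gc p u v) \<and>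
     (\<forall>p. \<forall>u\<in>E p. \<forall>w\<in>F p. g p u w = 0)"

definition horizontal_connection ::
  "nat \<Rightarrow> ('a \<Rightarrow> 'a tvec \<Rightarrow> 'a tvec \<Rightarrow> real) \<Rightarrow> ('a vfield \<Rightarrow> 'a vfield \<Rightarrow> 'a vfield)
     \<Rightarrow> (nat \<Rightarrow> 'a vfield) \<Rightarrow> 'a vfield \<Rightarrow> 'a vfield \<Rightarrow> 'a vfield" where
  "horizontal_connection k g nabla X U V =
     (\<lambda>p. \<Sum>i<k. g p (nabla U V p) (X i p) *\<^sub>R X i p)"

end

theory Submission
  imports Defs
begin

text \<open>The connection is determined by Koszul's formula. If \<open>D\<close> is a metric connection on a bundle \<open>E\<close> whose
  torsion is measured by a bracket \<open>br\<close>, then \<open>2 * g (D U V) W\<close> equals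
  \<open>U (g V W) + V (g U W) - W (g U V) + g (br U V) W - g (br U W) V - g (br V W) U\<close>
  (\<open>koszul_identity\<close>), an expression without \<open>D\<close>. Every vector of \<open>E\<close> is the value of a global section, so
  there is at most one such \<open>D\<close>.

  For existence, take the Lie bracket projected to \<open>E\<close> along a complement \<open>F\<close>. It is still biadditive,
  antisymmetric and satisfies a Leibniz rule in each argument, and this makes the Koszul expression
  linear over functions in \<open>U\<close> and \<open>W\<close>, with a Leibniz rule in \<open>V\<close>. On the fields of an orthonormal
  frame it is twice the Christoffel symbol of the statement, since derivatives of the constant metric
  coefficients vanish. Expanding all arguments in the frame shows that the connection defined by the frame
  satisfies Koszul's formula (\<open>frame_connection_koszul\<close>). Hence it does not depend on the frame, and its
  properties are properties of the Koszul expression: linearity and the Leibniz rule as above, the metric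
  property by symmetrizing in \<open>V\<close> and \<open>W\<close> (\<open>koszul_metric\<close>), the torsion by antisymmetrizing in \<open>U\<close> and \<open>V\<close>
  (\<open>koszul_torsion\<close>).

  The Levi-Civita connection of an orthogonal extension satisfies Koszul's formula for the full Lie bracket.
  Tested against sections of \<open>E\<close>, the full and the projected bracket give the same inner products, so the
  projection of the Levi-Civita connection is \<open>D\<close> (\<open>levi_civita_horizontal\<close>).

  Analysis enters in three places. Bump functions provide global sections with prescribed values
  (\<open>global_section_through\<close>). Gram-Schmidt provides local orthonormal frames (\<open>gram_schmidt\<close>). The projected
  bracket is smooth because the coefficients of a smooth vector field in a local frame are smooth. As tangent
  vectors are derivations, this follows by eliminating one frame field after the other, with a function that
  the field does not annihilate as pivot (\<open>smooth_coefficients\<close>).\<close>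


section \<open>Calculus of C^n functions on open sets\<close>

lemma Ck_on_subset:
  assumes "Ck_on n S f" "T \<subseteq> S"
  shows "Ck_on n T f"
  using assms
  by (induction n arbitrary: f) (auto intro: continuous_on_subset)

lemma Ck_on_Suc_imp_Ck_on:
  assumes "Ck_on (Suc n) S f"
  shows "Ck_on n S f"
  using assms
proof (induction n arbitrary: f)
  case 0
  then show ?case
    by (auto intro!: continuous_at_imp_continuous_on differentiable_imp_continuous_within)
next
  case (Suc n)
  then show ?case by (metis Ck_on.simps(2))
qed

lemma Ck_on_transfer:
  assumes "open S" "Ck_on n S f" "\<And>x. x \<in> S \<Longrightarrow> f x = g x"
  shows "Ck_on n S g"
  using assms(2,3)
proof (induction n arbitrary: f g)
  case 0
  then show ?case
    using continuous_on_cong[of S S f g] by simp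
next
  case (Suc n)
  have f: "f differentiable (at x)" if "x \<in> S" for x
    using Suc.prems(1) that by simp
  have g: "g differentiable (at x)" if x: "x \<in> S" for x
    using f[OF x] unfolding differentiable_def
    by (blast intro: has_derivative_transform_within_open[OF _ assms(1) x] Suc.prems(2))
  have eq: "frechet_derivative f (at x) v = frechet_derivative g (at x) v" if x: "x \<in> S" for x v
    using frechet_derivative_transform_within_open[OF f[OF x] assms(1) x, of g] Suc.prems(2) by simp
  have "Ck_on n S (\<lambda>x. frechet_derivative g (at x) v)" for v
    by (rule Suc.IH[of "\<lambda>x. frechet_derivative f (at x) v"])
      (use Suc.prems(1) eq in auto)
  with g show ?case by simp
qed

lemma Ck_on_local:
  assumes "\<And>x. x \<in> S \<Longrightarrow> \<exists>T. open T \<and> x \<in> T \<and> Ck_on n T f"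
  shows "Ck_on n S f"
  using assms
proof (induction n arbitrary: f)
  case 0
  have "isCont f x" if "x \<in> S" for x
    using 0[OF that] by (auto simp: continuous_on_eq_continuous_at)
  then show ?case by (simp add: continuous_at_imp_continuous_on)
next
  case (Suc n)
  have "Ck_on n S (\<lambda>x. frechet_derivative f (at x) v)" for v
  proof (rule Suc.IH)
    fix x
    assume "x \<in> S"
    from Suc.prems[OF this]
    show "\<exists>T. open T \<and> x \<in> T \<and> Ck_on n T (\<lambda>x. frechet_derivative f (at x) v)" by auto
  qed
  moreover have "f differentiable (at x)" if "x \<in> S" for x
    using Suc.prems[OF that] by auto
  ultimately show ?case by simp
qed

text \<open>All closure properties below go by induction on the order of differentiability: the derivative
  of the compound function is expressed through functions of the same kind.\<close>

lemma Ck_on_SucI: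
  assumes "open S" "\<And>x. x \<in> S \<Longrightarrow> (f has_derivative f' x) (at x)"
    and "\<And>v. Ck_on n S (\<lambda>x. f' x v)"
  shows "Ck_on (Suc n) S f"
proof -
  have eq: "f' x = frechet_derivative f (at x)" if "x \<in> S" for x
    by (rule frechet_derivative_at[OF assms(2)[OF that]])
  have "Ck_on n S (\<lambda>x. frechet_derivative f (at x) v)" for v
    by (rule Ck_on_transfer[OF assms(1) assms(3)[of v]]) (simp add: eq)
  moreover have "f differentiable (at x)" if "x \<in> S" for x
    unfolding differentiable_def using assms(2)[OF that] by blast
  ultimately show ?thesis by simp
qed

lemma Ck_on_SucI_real:
  fixes f :: "real \<Rightarrow> real"
  assumes "open S" "\<And>x. x \<in> S \<Longrightarrow> (f has_real_derivative f' x) (at x)"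
    and "\<And>c. Ck_on n S (\<lambda>x. f' x * c)"
  shows "Ck_on (Suc n) S f"
  using assms(1) assms(2)[unfolded has_field_derivative_def] assms(3) by (rule Ck_on_SucI)

lemma Ck_on_SucD:
  assumes "Ck_on (Suc n) S f"
  obtains f' where "\<And>x. x \<in> S \<Longrightarrow> (f has_derivative f' x) (at x)" "\<And>v. Ck_on n S (\<lambda>x. f' x v)"
proof (rule that)
  show "(f has_derivative frechet_derivative f (at x)) (at x)" if "x \<in> S" for x
    using assms that frechet_derivative_works by auto
  show "Ck_on n S (\<lambda>x. frechet_derivative f (at x) v)" for v
    using assms by simp
qed

lemma Ck_on_const: "open S \<Longrightarrow> Ck_on n S (\<lambda>x. c)"
  by (induction n arbitrary: c) simp_all

lemma Ck_on_add:
  assumes "open S" "Ck_on n S f" "Ck_on n S g"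
  shows "Ck_on n S (\<lambda>x. f x + g x)"
  using assms(2,3)
proof (induction n arbitrary: f g)
  case 0
  then show ?case by (simp add: continuous_on_add)
next
  case (Suc n)
  obtain f' where f': "\<And>x. x \<in> S \<Longrightarrow> (f has_derivative f' x) (at x)" "\<And>v. Ck_on n S (\<lambda>x. f' x v)"
    using Suc.prems(1) by (rule Ck_on_SucD) blast
  obtain g' where g': "\<And>x. x \<in> S \<Longrightarrow> (g has_derivative g' x) (at x)" "\<And>v. Ck_on n S (\<lambda>x. g' x v)"
    using Suc.prems(2) by (rule Ck_on_SucD) blast
  show ?case
    by (rule Ck_on_SucI[where f' = "\<lambda>x v. f' x v + g' x v"])
      (use assms f' g' Suc.IH in \<open>simp_all add: has_derivative_add\<close>)
qed

lemma Ck_on_bilinear: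
  assumes "open S" "bounded_bilinear B" "Ck_on n S f" "Ck_on n S g"
  shows "Ck_on n S (\<lambda>x. B (f x) (g x))"
  using assms(3,4)
proof (induction n arbitrary: f g)
  case 0
  then show ?case using bounded_bilinear.continuous_on[OF assms(2), of S f g] by simp
next
  case (Suc n)
  obtain f' where f': "\<And>x. x \<in> S \<Longrightarrow> (f has_derivative f' x) (at x)" "\<And>v. Ck_on n S (\<lambda>x. f' x v)"
    using Suc.prems(1) by (rule Ck_on_SucD) blast
  obtain g' where g': "\<And>x. x \<in> S \<Longrightarrow> (g has_derivative g' x) (at x)" "\<And>v. Ck_on n S (\<lambda>x. g' x v)"
    using Suc.prems(2) by (rule Ck_on_SucD) blast
  note fg = Suc.prems[THEN Ck_on_Suc_imp_Ck_on]
  show ?case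
    by (rule Ck_on_SucI[where f' = "\<lambda>x v. B (f x) (g' x v) + B (f' x v) (g x)"])
      (use assms(1) f' g' fg in
        \<open>simp_all add: bounded_bilinear.FDERIV[OF assms(2)] Suc.IH Ck_on_add\<close>)
qed

lemmas Ck_on_mult = Ck_on_bilinear[OF _ bounded_bilinear_mult]
  and Ck_on_inner = Ck_on_bilinear[OF _ bounded_bilinear_inner]

text \<open>The outer function is a power of a metric coefficient in the Gram-Schmidt process, or the radial
  profile of a bump function. Its derivative is again a function of one real variable, so the induction
  hypothesis applies to it.\<close>

lemma Ck_on_compose_real:
  fixes h :: "real \<Rightarrow> real"
  assumes "open S" "\<And>n. Ck_on n T h" "f ` S \<subseteq> T" "Ck_on n S f"
  shows "Ck_on n S (\<lambda>x. h (f x))"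
  using assms(2,4)
proof (induction n arbitrary: h)
  case 0
  show ?case
    using 0(1)[of 0] 0(2) assms(3) continuous_on_compose2[of T h S f] by simp
next
  case (Suc n)
  obtain f' where f': "\<And>x. x \<in> S \<Longrightarrow> (f has_derivative f' x) (at x)" "\<And>v. Ck_on n S (\<lambda>x. f' x v)"
    using Suc.prems(2) by (rule Ck_on_SucD) blast
  define h' where "h' t = frechet_derivative h (at t) 1" for t
  have h': "Ck_on m T h'" for m
  proof -
    have "\<forall>v. Ck_on m T (\<lambda>x. frechet_derivative h (at x) v)"
      using Suc.prems(1)[of "Suc m"] by simp
    then show ?thesis unfolding h'_def by blast
  qed
  have dh: "(h has_derivative (\<lambda>v. h' t * v)) (at t)" if "t \<in> T" for t
  proof -
    have d: "(h has_derivative frechet_derivative h (at t)) (at t)"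
      using Suc.prems(1)[of "Suc 0"] that frechet_derivative_works by auto
    then interpret bounded_linear "frechet_derivative h (at t)" by (rule has_derivative_bounded_linear)
    have "frechet_derivative h (at t) v = h' t * v" for v
      using scaleR[of v 1] unfolding h'_def real_scaleR_def mult_1_right
      by (rule trans) (rule mult.commute)
    then have "frechet_derivative h (at t) = (\<lambda>v. h' t * v)" by (rule ext)
    with d show ?thesis by (rule subst[rotated])
  qed
  have "Ck_on n S f" using Suc.prems(2) by (rule Ck_on_Suc_imp_Ck_on)
  with h' have h'f: "Ck_on n S (\<lambda>x. h' (f x))" by (rule Suc.IH)
  show ?case
  proof (rule Ck_on_SucI[where f' = "\<lambda>x v. h' (f x) * f' x v"])
    show "((\<lambda>x. h (f x)) has_derivative (\<lambda>v. h' (f x) * f' x v)) (at x)" if "x \<in> S" for x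
    proof -
      have "f x \<in> T" using assms(3) that by blast
      then show ?thesis by (rule has_derivative_compose[OF f'(1)[OF that] dh])
    qed
    show "Ck_on n S (\<lambda>x. h' (f x) * f' x v)" for v
      by (rule Ck_on_mult[OF assms(1) h'f f'(2)])
  qed (rule assms(1))
qed

lemma Ck_on_powr: "Ck_on n {0<..} (\<lambda>x::real. x powr a)"
proof (induction n arbitrary: a)
  case 0
  then show ?case by (auto intro!: continuous_intros)
next
  case (Suc n)
  show ?case
    by (rule Ck_on_SucI_real[where f' = "\<lambda>x. a * x powr (a - 1)"])
      (use Suc in \<open>simp_all add: Ck_on_mult Ck_on_const has_real_derivative_powr\<close>)
qed

text \<open>The classical flat function \<open>exp (- 1 / x)\<close>, extended by zero, is the case \<open>n = 0\<close>; the extra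
  powers make the family closed under differentiation up to linear combinations.\<close>

definition flat :: "nat \<Rightarrow> real \<Rightarrow> real" where
  "flat n x = (if 0 < x then inverse x ^ n * exp (- inverse x) else 0)"

lemma tendsto_flat_at_right_0: "(flat n \<longlongrightarrow> 0) (at_right 0)"
proof -
  have "((\<lambda>x::real. inverse x ^ n / exp (inverse x)) \<longlongrightarrow> 0) (at_right 0)"
    by (rule filterlim_compose[OF tendsto_power_div_exp_0 filterlim_inverse_at_top_right])
  moreover have "\<forall>\<^sub>F x in at_right 0. inverse x ^ n / exp (inverse x) = flat n x"
    by (auto simp: eventually_at_filter flat_def exp_minus divide_inverse)
  ultimately show ?thesis by (rule Lim_transform_eventually)
qed

text \<open>At the origin the difference quotient of \<open>flat n\<close> is \<open>flat (n + 1)\<close> from the right and \<open>0\<close> from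
  the left, so both one-sided limits vanish.\<close>

lemma has_derivative_flat:
  "(flat n has_real_derivative flat (n + 2) x - n * flat (n + 1) x) (at x)"
proof -
  consider "0 < x" | "x < 0" | "x = 0" by linarith
  then show ?thesis
  proof cases
    case 1
    have "((\<lambda>x. inverse x ^ n) has_real_derivative
        real n * inverse x ^ (n - 1) * - (inverse x * inverse x)) (at x)"
      using DERIV_power[OF DERIV_inverse[of x UNIV], of n] 1 by (simp add: power2_eq_square mult_ac)
    moreover have "((\<lambda>x. exp (- inverse x)) has_real_derivative
        exp (- inverse x) * (inverse x * inverse x)) (at x)"
      using 1 by (auto intro!: derivative_eq_intros)
    ultimately have "((\<lambda>x. inverse x ^ n * exp (- inverse x)) has_real_derivative
        real n * inverse x ^ (n - 1) * - (inverse x * inverse x) * exp (- inverse x) +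
        exp (- inverse x) * (inverse x * inverse x) * inverse x ^ n) (at x)"
      by (rule DERIV_mult)
    also have "real n * inverse x ^ (n - 1) * - (inverse x * inverse x) * exp (- inverse x) +
        exp (- inverse x) * (inverse x * inverse x) * inverse x ^ n =
        flat (n + 2) x - n * flat (n + 1) x"
      using 1 by (cases n) (simp_all add: flat_def)
    finally have "((\<lambda>x. inverse x ^ n * exp (- inverse x)) has_real_derivative
        flat (n + 2) x - n * flat (n + 1) x) (at x)" .
    then show ?thesis
      by (rule has_field_derivative_transform_within_open[where S = "{0<..}"]) (use 1 in \<open>auto simp: flat_def\<close>)
  next
    case 2
    have "((\<lambda>x. 0) has_real_derivative flat (n + 2) x - n * flat (n + 1) x) (at x)"
      using 2 by (simp add: flat_def)
    then show ?thesis
      by (rule has_field_derivative_transform_within_open[where S = "{..<0}"])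
        (use 2 in \<open>auto simp: flat_def\<close>)
  next
    case 3
    have "((\<lambda>h. (flat n (0 + h) - flat n 0) / h) \<longlongrightarrow> 0) (at 0)"
    proof (rule filterlim_split_at)
      have "\<forall>\<^sub>F h in at_left 0. 0 = (flat n (0 + h) - flat n 0) / h"
        by (auto simp: eventually_at_filter flat_def)
      then show "((\<lambda>h. (flat n (0 + h) - flat n 0) / h) \<longlongrightarrow> 0) (at_left 0)"
        by (rule Lim_transform_eventually[OF tendsto_const])
      have "\<forall>\<^sub>F h in at_right 0. flat (Suc n) h = (flat n (0 + h) - flat n 0) / h"
        by (auto simp: eventually_at_filter flat_def divide_inverse)
      then show "((\<lambda>h. (flat n (0 + h) - flat n 0) / h) \<longlongrightarrow> 0) (at_right 0)"
        by (rule Lim_transform_eventually[OF tendsto_flat_at_right_0])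
    qed
    then show ?thesis using 3 by (simp add: DERIV_def flat_def)
  qed
qed

lemma Ck_on_flat: "Ck_on m UNIV (flat n)"
proof (induction m arbitrary: n)
  case 0
  then show ?case
    using DERIV_isCont[OF has_derivative_flat] by (auto intro!: continuous_at_imp_continuous_on)
next
  case (Suc m)
  have *: "Ck_on m UNIV (\<lambda>x. (flat (n + 2) x + (- real n) * flat (n + 1) x) * c)" for c
    by (intro Ck_on_mult Ck_on_add Ck_on_const Suc open_UNIV)
  show ?case
    by (rule Ck_on_SucI_real[OF open_UNIV has_derivative_flat]) (use * in simp)
qed


section \<open>Germs of smooth functions\<close>

text \<open>Smoothness of functions, vector fields and sections is treated pointwise, through germs: a statement
  about an open set is the conjunction of the statements about its points, and conditions that hold near
  a point combine as eventualities.\<close>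

locale smooth_manifold =
  fixes A :: "('a::{t2_space, second_countable_topology}, 'e::euclidean_space) atlas"
  assumes atlas: "smooth_atlas A"
begin

lemma chartD:
  assumes "(W, \<phi>) \<in> A"
  shows "open W" "open (\<phi> ` W)" "homeomorphism W (\<phi> ` W) \<phi> (inv_into W \<phi>)"
  using atlas assms unfolding smooth_atlas_def by blast+

lemma chart_inv: "(W, \<phi>) \<in> A \<Longrightarrow> q \<in> W \<Longrightarrow> inv_into W \<phi> (\<phi> q) = q"
  using chartD(3) homeomorphism_apply1 by blast

lemma chart_at: obtains W \<phi> where "(W, \<phi>) \<in> A" "p \<in> W"
  using atlas unfolding smooth_atlas_def by blast

lemma chart_transition:
  assumes "(W, \<phi>) \<in> A" "(W', \<phi>') \<in> A"
  shows "Ck_on n (\<phi> ` (W \<inter> W')) (\<lambda>x. \<phi>' (inv_into W \<phi> x))"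
  using atlas assms unfolding smooth_atlas_def smooth_on_def comp_def by blast

lemma open_chart_image:
  assumes "(W, \<phi>) \<in> A" "open S"
  shows "open (\<phi> ` (S \<inter> W))"
proof -
  have "openin (top_of_set W) (S \<inter> W)" using assms(2) unfolding openin_open by blast
  then have "openin (top_of_set (\<phi> ` W)) (\<phi> ` (S \<inter> W))"
    using homeomorphism_imp_open_map[OF chartD(3)[OF assms(1)]] by blast
  then show ?thesis using chartD(2)[OF assms(1)] by (simp add: openin_open_eq)
qed

lemma smooth_fun_onD:
  "smooth_fun_on A S f \<Longrightarrow> (W, \<phi>) \<in> A \<Longrightarrow> Ck_on n (\<phi> ` (S \<inter> W)) (\<lambda>x. f (inv_into W \<phi> x))"
  unfolding smooth_fun_on_def smooth_on_def comp_def by blast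

lemma smooth_fun_onI:
  "(\<And>n W \<phi>. (W, \<phi>) \<in> A \<Longrightarrow> Ck_on n (\<phi> ` (S \<inter> W)) (\<lambda>x. f (inv_into W \<phi> x))) \<Longrightarrow> smooth_fun_on A S f"
  unfolding smooth_fun_on_def smooth_on_def comp_def by blast

lemma smooth_fun_on_subset: "smooth_fun_on A S f \<Longrightarrow> T \<subseteq> S \<Longrightarrow> smooth_fun_on A T f"
  by (rule smooth_fun_onI) (blast intro: Ck_on_subset[OF smooth_fun_onD])

lemma smooth_fun_on_iff_near:
  assumes "open S"
  shows "smooth_fun_on A S f \<longleftrightarrow> (\<forall>p\<in>S. smooth_near A p f)"
proof
  show "smooth_fun_on A S f \<Longrightarrow> \<forall>p\<in>S. smooth_near A p f"
    using assms by (auto simp: smooth_near_def)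
  assume near: "\<forall>p\<in>S. smooth_near A p f"
  show "smooth_fun_on A S f"
  proof (intro smooth_fun_onI Ck_on_local)
    fix n W \<phi> x
    assume W: "(W, \<phi>) \<in> A" and "x \<in> \<phi> ` (S \<inter> W)"
    then obtain q where q: "q \<in> S" "q \<in> W" "x = \<phi> q" by auto
    then obtain N where N: "open N" "q \<in> N" "smooth_fun_on A N f"
      using near by (auto simp: smooth_near_def)
    show "\<exists>T. open T \<and> x \<in> T \<and> Ck_on n T (\<lambda>x. f (inv_into W \<phi> x))"
      using open_chart_image[OF W N(1)] smooth_fun_onD[OF N(3) W] q N(2) by blast
  qed
qed

lemma smooth_nearE:
  assumes "smooth_near A p f"
  obtains S where "open S" "p \<in> S" "smooth_fun_on A S f"
  using assms unfolding smooth_near_def by blast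

lemma eventually_smooth_near:
  assumes "smooth_near A p f"
  shows "\<forall>\<^sub>F q in nhds p. smooth_near A q f"
  using assms unfolding eventually_nhds smooth_near_def by blast

lemma smooth_near_cong:
  assumes "smooth_near A p f" "\<forall>\<^sub>F q in nhds p. f q = g q"
  shows "smooth_near A p g"
proof -
  obtain S where S: "open S" "p \<in> S" "smooth_fun_on A S f" using assms(1) by (rule smooth_nearE)
  obtain N where N: "open N" "p \<in> N" "\<And>q. q \<in> N \<Longrightarrow> f q = g q"
    using assms(2) by (auto simp: eventually_nhds)
  have "smooth_fun_on A (S \<inter> N) g"
  proof (rule smooth_fun_onI)
    fix n W \<phi>
    assume W: "(W, \<phi>) \<in> A"
    show "Ck_on n (\<phi> ` (S \<inter> N \<inter> W)) (\<lambda>x. g (inv_into W \<phi> x))"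
    proof (rule Ck_on_transfer)
      show "open (\<phi> ` (S \<inter> N \<inter> W))" using open_chart_image[OF W] S(1) N(1) by blast
      show "Ck_on n (\<phi> ` (S \<inter> N \<inter> W)) (\<lambda>x. f (inv_into W \<phi> x))"
        by (rule Ck_on_subset[OF smooth_fun_onD[OF S(3) W]]) blast
    qed (use N(3) chart_inv[OF W] in auto)
  qed
  then show ?thesis unfolding smooth_near_def using S N by (meson IntI open_Int)
qed

text \<open>Every operation on functions that preserves \<open>Ck_on\<close> in charts preserves germs of smooth
  functions.\<close>

lemma smooth_nearI_Ck_on:
  assumes "open S" "p \<in> S"
    and "\<And>n W \<phi>. (W, \<phi>) \<in> A \<Longrightarrow> open (\<phi> ` (S \<inter> W)) \<Longrightarrow>
      Ck_on n (\<phi> ` (S \<inter> W)) (\<lambda>x. f (inv_into W \<phi> x))"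
  shows "smooth_near A p f"
  unfolding smooth_near_def
  using assms(1,2) smooth_fun_onI[of S f] assms(3) open_chart_image[OF _ assms(1)] by blast

lemma smooth_near_const: "smooth_near A p (\<lambda>q. c)"
  by (rule smooth_nearI_Ck_on[of UNIV]) (auto intro: Ck_on_const)

lemma smooth_near_common:
  assumes "smooth_near A p f" "smooth_near A p g"
  obtains S where "open S" "p \<in> S" "smooth_fun_on A S f" "smooth_fun_on A S g"
proof -
  obtain S T where "open S" "p \<in> S" "smooth_fun_on A S f" "open T" "p \<in> T" "smooth_fun_on A T g"
    using assms by (metis smooth_nearE)
  then show thesis
    by (intro that[of "S \<inter> T"]) (auto intro: smooth_fun_on_subset)
qed

lemma smooth_near_add:
  assumes "smooth_near A p f" "smooth_near A p g"
  shows "smooth_near A p (\<lambda>q. f q + g q)"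
  using assms
  by (rule smooth_near_common) (auto intro!: smooth_nearI_Ck_on Ck_on_add dest: smooth_fun_onD)

lemma smooth_near_mult:
  assumes "smooth_near A p f" "smooth_near A p g"
  shows "smooth_near A p (\<lambda>q. f q * g q)"
  using assms
  by (rule smooth_near_common) (auto intro!: smooth_nearI_Ck_on Ck_on_mult dest: smooth_fun_onD)

lemma smooth_near_isCont:
  assumes "smooth_near A p f"
  shows "isCont f p"
proof -
  obtain S where S: "open S" "p \<in> S" "smooth_fun_on A S f" using assms by (rule smooth_nearE)
  obtain W \<phi> where W: "(W, \<phi>) \<in> A" "p \<in> W" by (rule chart_at)
  have "continuous_on (\<phi> ` (S \<inter> W)) (\<lambda>x. f (inv_into W \<phi> x))"
    using smooth_fun_onD[OF S(3) W(1), of 0] by simp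
  moreover have "continuous_on (S \<inter> W) \<phi>"
    using chartD(3)[OF W(1)] by (meson continuous_on_subset homeomorphism_cont1 inf_le2)
  ultimately have "continuous_on (S \<inter> W) (\<lambda>q. f (inv_into W \<phi> (\<phi> q)))"
    by (rule continuous_on_compose2) simp
  then have "continuous_on (S \<inter> W) f"
    by (rule continuous_on_eq) (simp add: chart_inv[OF W(1)])
  then show ?thesis
    using S W chartD(1)[OF W(1)] continuous_on_eq_continuous_at[of "S \<inter> W" f] by (simp add: open_Int)
qed

lemma eventually_smooth_near_in:
  assumes "smooth_near A p f" "open T" "f p \<in> T"
  shows "\<forall>\<^sub>F q in nhds p. f q \<in> T"
proof -
  have "(f \<longlongrightarrow> f p) (nhds p)"
    using smooth_near_isCont[OF assms(1)] by (simp add: isCont_def tendsto_at_iff_tendsto_nhds)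
  then show ?thesis using assms(2,3) by (rule topological_tendstoD)
qed

lemma smooth_near_compose_real:
  assumes "smooth_near A p f" "open T" "f p \<in> T" "\<And>n. Ck_on n T h"
  shows "smooth_near A p (\<lambda>q. h (f q))"
proof -
  obtain S where S: "open S" "p \<in> S" "smooth_fun_on A S f" using assms(1) by (rule smooth_nearE)
  obtain N where N: "open N" "p \<in> N" "\<And>q. q \<in> N \<Longrightarrow> f q \<in> T"
    using eventually_smooth_near_in[OF assms(1-3)] by (auto simp: eventually_nhds)
  show ?thesis
  proof (rule smooth_nearI_Ck_on[of "S \<inter> N"])
    fix n W \<phi>
    assume W: "(W, \<phi>) \<in> A" and o: "open (\<phi> ` (S \<inter> N \<inter> W))"
    show "Ck_on n (\<phi> ` (S \<inter> N \<inter> W)) (\<lambda>x. h (f (inv_into W \<phi> x)))"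
    proof (rule Ck_on_compose_real[OF o assms(4)])
      show "Ck_on n (\<phi> ` (S \<inter> N \<inter> W)) (\<lambda>x. f (inv_into W \<phi> x))"
        by (rule Ck_on_subset[OF smooth_fun_onD[OF S(3) W]]) blast
    qed (use N(3) chart_inv[OF W] in auto)
  qed (use S N in auto)
qed

lemma smooth_near_powr:
  assumes "smooth_near A p f" "0 < f p"
  shows "smooth_near A p (\<lambda>q. f q powr a)"
  by (rule smooth_near_compose_real[where T = "{0<..}"]) (use assms Ck_on_powr in auto)

lemma smooth_near_cmult: "smooth_near A p f \<Longrightarrow> smooth_near A p (\<lambda>q. c * f q)"
  by (rule smooth_near_mult[OF smooth_near_const])

lemma smooth_near_uminus: "smooth_near A p f \<Longrightarrow> smooth_near A p (\<lambda>q. - f q)"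
  using smooth_near_cmult[of p f "-1"] by simp

lemma smooth_near_diff:
  "smooth_near A p f \<Longrightarrow> smooth_near A p g \<Longrightarrow> smooth_near A p (\<lambda>q. f q - g q)"
  using smooth_near_add[OF _ smooth_near_uminus, of p f g] by simp

lemma smooth_near_sum:
  "(\<And>i. i \<in> I \<Longrightarrow> smooth_near A p (f i)) \<Longrightarrow> smooth_near A p (\<lambda>q. \<Sum>i\<in>I. f i q)"
  by (induction I rule: infinite_finite_induct) (auto intro: smooth_near_const smooth_near_add)

lemma smooth_near_divide:
  assumes "smooth_near A p f" "smooth_near A p g" "g p \<noteq> 0"
  shows "smooth_near A p (\<lambda>q. f q / g q)"
proof -
  have "smooth_near A p (\<lambda>q. f q * (g q * (g q * g q) powr - 1))"
    using assms zero_less_mult_iff[of "g p" "g p"]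
    by (intro smooth_near_mult smooth_near_powr) auto
  \<comment> \<open>The square makes the base of the power positive; at a zero of \<open>g\<close> both sides are \<open>0\<close>.\<close>
  moreover have "x * (x * x) powr - 1 = inverse x" for x :: real
    by (cases "x = 0") (simp_all add: powr_minus)
  ultimately show ?thesis by (simp only: divide_inverse)
qed


section \<open>Tangent vectors\<close>

lemma tangent_add:
  "v \<in> tangent_space A p \<Longrightarrow> smooth_near A p f \<Longrightarrow> smooth_near A p g \<Longrightarrow>
    v (\<lambda>q. f q + g q) = v f + v g"
  unfolding tangent_space_def by blast

lemma tangent_cmult:
  "v \<in> tangent_space A p \<Longrightarrow> smooth_near A p f \<Longrightarrow> v (\<lambda>q. c * f q) = c * v f"
  unfolding tangent_space_def by blast

lemma tangent_mult:
  "v \<in> tangent_space A p \<Longrightarrow> smooth_near A p f \<Longrightarrow> smooth_near A p g \<Longrightarrow>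
    v (\<lambda>q. f q * g q) = f p * v g + g p * v f"
  unfolding tangent_space_def by blast

lemma tangent_cong:
  "v \<in> tangent_space A p \<Longrightarrow> smooth_near A p f \<Longrightarrow> \<forall>\<^sub>F q in nhds p. f q = g q \<Longrightarrow> v f = v g"
  unfolding tangent_space_def by blast

lemma tangent_not_smooth: "v \<in> tangent_space A p \<Longrightarrow> \<not> smooth_near A p f \<Longrightarrow> v f = 0"
  unfolding tangent_space_def by blast

lemma tangentI:
  assumes "\<And>f g. smooth_near A p f \<Longrightarrow> smooth_near A p g \<Longrightarrow> v (\<lambda>q. f q + g q) = v f + v g"
    and "\<And>c f. smooth_near A p f \<Longrightarrow> v (\<lambda>q. c * f q) = c * v f"
    and "\<And>f g. smooth_near A p f \<Longrightarrow> smooth_near A p g \<Longrightarrow> v (\<lambda>q. f q * g q) = f p * v g + g p * v f"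
    and "\<And>f g. smooth_near A p f \<Longrightarrow> \<forall>\<^sub>F q in nhds p. f q = g q \<Longrightarrow> v f = v g"
    and "\<And>f. \<not> smooth_near A p f \<Longrightarrow> v f = 0"
  shows "v \<in> tangent_space A p"
  unfolding tangent_space_def using assms by blast

text \<open>The Leibniz rule for \<open>1 * 1 = 1\<close> gives \<open>v 1 = 2 * v 1\<close>.\<close>

lemma tangent_const:
  assumes "v \<in> tangent_space A p"
  shows "v (\<lambda>q. c) = 0"
proof -
  have "v (\<lambda>q. 1 * 1) = 1 * v (\<lambda>q. 1) + 1 * v (\<lambda>q. 1)"
    by (rule tangent_mult[OF assms smooth_near_const smooth_near_const])
  then have "v (\<lambda>q. 1) = 0" by simp
  then show ?thesis using tangent_cmult[OF assms smooth_near_const, of c 1] by simp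
qed

lemma subspace_tangent_space: "subspace (tangent_space A p)"
proof (rule subspaceI)
  show "0 \<in> tangent_space A p" by (rule tangentI) auto
next
  fix u v
  assume "u \<in> tangent_space A p" "v \<in> tangent_space A p"
  then show "u + v \<in> tangent_space A p"
    by (intro tangentI)
      (auto simp: tangent_add tangent_cmult tangent_mult tangent_not_smooth algebra_simps
        intro!: arg_cong2[where f = plus] intro: tangent_cong)
next
  fix c v
  assume "v \<in> tangent_space A p"
  then show "c *\<^sub>R v \<in> tangent_space A p"
    by (intro tangentI)
      (auto simp: scaleR_fun_def tangent_add tangent_cmult tangent_mult tangent_not_smooth algebra_simps
        intro: tangent_cong)
qed

end


section \<open>Germs of sections and Lie brackets\<close>

lemma sum_fun_apply: "(\<Sum>i\<in>I. f i) x = (\<Sum>i\<in>I. f i x)"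
  by (induction I rule: infinite_finite_induct) auto

lemma sum_scaleR_apply:
  fixes v :: "'i \<Rightarrow> 'b \<Rightarrow> real"
  shows "(\<Sum>i\<in>I. c i *\<^sub>R v i) x = (\<Sum>i\<in>I. c i * v i x)"
  by (simp add: sum_fun_apply scaleR_fun_def)

text \<open>The condition is imposed at all points near \<open>p\<close>: that the germ at \<open>p\<close> alone maps smooth germs to
  smooth germs would leave a neighbourhood that depends on the function.\<close>

definition section_near ::
  "('a::topological_space, 'e::euclidean_space) atlas \<Rightarrow> ('a \<Rightarrow> 'a tvec set) \<Rightarrow> 'a \<Rightarrow> 'a vfield
    \<Rightarrow> bool" where
  "section_near A E p X \<longleftrightarrow>
     (\<forall>\<^sub>F q in nhds p. X q \<in> E q \<and> X q \<in> tangent_space A q \<and>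
        (\<forall>f. smooth_near A q f \<longrightarrow> smooth_near A q (\<lambda>r. X r f)))"

abbreviation "vfield_near A \<equiv> section_near A (tangent_space A)"

context smooth_manifold
begin

lemma section_near_in: "section_near A E p X \<Longrightarrow> X p \<in> E p"
  unfolding section_near_def by (drule eventually_nhds_x_imp_x) blast

lemma section_near_smooth: "section_near A E p X \<Longrightarrow> smooth_near A p f \<Longrightarrow> smooth_near A p (\<lambda>q. X q f)"
  unfolding section_near_def by (drule eventually_nhds_x_imp_x) blast

lemma eventually_section_near:
  "section_near A E p X \<Longrightarrow> \<forall>\<^sub>F q in nhds p. section_near A E q X"
  unfolding section_near_def by (simp add: eventually_eventually)

lemma section_near_eventually_in: "section_near A E p X \<Longrightarrow> \<forall>\<^sub>F q in nhds p. X q \<in> E q"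
  unfolding section_near_def by (auto elim: eventually_mono)

lemma section_near_tangent: "section_near A E p X \<Longrightarrow> vfield_near A p X"
  unfolding section_near_def by (auto elim: eventually_mono)

lemma tangent_of_section_near: "section_near A E p X \<Longrightarrow> X p \<in> tangent_space A p"
  using section_near_in section_near_tangent by blast

lemma section_nearI:
  assumes "vfield_near A p X" "\<forall>\<^sub>F q in nhds p. X q \<in> E q"
  shows "section_near A E p X"
  using assms unfolding section_near_def by eventually_elim blast

lemma vfield_nearI:
  assumes "\<forall>\<^sub>F q in nhds p. X q \<in> tangent_space A q"
    and "\<forall>\<^sub>F q in nhds p. \<forall>f. smooth_near A q f \<longrightarrow> smooth_near A q (\<lambda>r. X r f)"
  shows "vfield_near A p X"
  using assms unfolding section_near_def by eventually_elim blast

lemma vector_field_on_iff_near: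
  assumes "open S"
  shows "vector_field_on A S X \<longleftrightarrow> (\<forall>p\<in>S. vfield_near A p X)"
proof
  assume X: "vector_field_on A S X"
  have "smooth_near A p (\<lambda>q. X q f)" if p: "p \<in> S" and f: "smooth_near A p f" for p f
  proof -
    obtain N where N: "open N" "p \<in> N" "smooth_fun_on A N f" using f by (rule smooth_nearE)
    have "smooth_fun_on A (N \<inter> S) (\<lambda>q. X q f)"
      using X smooth_fun_on_subset[OF N(3), of "N \<inter> S"] N(1) assms
      unfolding vector_field_on_def by (meson inf_le1 inf_le2 open_Int)
    then show ?thesis unfolding smooth_near_def using N assms p by (meson IntI open_Int)
  qed
  moreover have "X p \<in> tangent_space A p" if "p \<in> S" for p
    using X that unfolding vector_field_on_def by blast
  ultimately show "\<forall>p\<in>S. vfield_near A p X"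
    unfolding section_near_def eventually_nhds using assms by blast
next
  assume X: "\<forall>p\<in>S. vfield_near A p X"
  then have "X p \<in> tangent_space A p" if "p \<in> S" for p
    using tangent_of_section_near that by blast
  moreover have "smooth_fun_on A W (\<lambda>p. X p f)"
    if "open W" "W \<subseteq> S" "smooth_fun_on A W f" for W f
    using that X by (auto simp: smooth_fun_on_iff_near intro: section_near_smooth)
  ultimately show "vector_field_on A S X" unfolding vector_field_on_def by blast
qed

lemma sections_iff_near:
  assumes "open S"
  shows "X \<in> sections A E S \<longleftrightarrow> (\<forall>p\<in>S. section_near A E p X)"
proof
  assume X: "X \<in> sections A E S"
  show "\<forall>p\<in>S. section_near A E p X"
  proof
    fix p
    assume p: "p \<in> S"
    have "vfield_near A p X"
      using X p vector_field_on_iff_near[OF assms] unfolding sections_def by blast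
    moreover have "\<forall>\<^sub>F q in nhds p. X q \<in> E q"
      using X assms p unfolding sections_def eventually_nhds by blast
    ultimately show "section_near A E p X" by (rule section_nearI)
  qed
next
  assume "\<forall>p\<in>S. section_near A E p X"
  then show "X \<in> sections A E S"
    unfolding sections_def vector_field_on_iff_near[OF assms]
    using section_near_in section_near_tangent by blast
qed

lemma section_near_cong:
  assumes "section_near A E p X" "\<forall>\<^sub>F q in nhds p. X q = Y q"
  shows "section_near A E p Y"
proof -
  have "\<forall>\<^sub>F q in nhds p. \<forall>\<^sub>F r in nhds q. X r = Y r"
    using assms(2) by (simp add: eventually_eventually)
  then show ?thesis
    using assms unfolding section_near_def
  proof eventually_elim
    case (elim q)
    have "smooth_near A q (\<lambda>r. Y r f)" if "smooth_near A q f" for f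
    proof (rule smooth_near_cong)
      show "smooth_near A q (\<lambda>r. X r f)" using elim(2) that by blast
      show "\<forall>\<^sub>F r in nhds q. X r f = Y r f" using elim(1) by eventually_elim simp
    qed
    then show ?case using elim(2,3) by simp
  qed
qed

lemma section_near_add:
  assumes "\<And>q. subspace (E q)" "section_near A E p X" "section_near A E p Y"
  shows "section_near A E p (X + Y)"
  using assms(2,3) unfolding section_near_def
  by eventually_elim
    (use assms(1) subspace_tangent_space in \<open>auto intro: subspace_add smooth_near_add\<close>)

lemma section_near_zero:
  assumes "\<And>q. subspace (E q)"
  shows "section_near A E p 0"
  unfolding section_near_def
  by (rule always_eventually)
    (use assms subspace_tangent_space smooth_near_const[of _ 0] in \<open>auto intro: subspace_0\<close>)

lemma section_near_fun_scale:
  assumes "\<And>q. subspace (E q)" "smooth_near A p f" "section_near A E p X"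
  shows "section_near A E p (fun_scale f X)"
  using eventually_smooth_near[OF assms(2)] assms(3) unfolding section_near_def
proof eventually_elim
  case (elim q)
  have "smooth_near A q (\<lambda>r. fun_scale f X r h)" if "smooth_near A q h" for h
    using elim that by (simp add: fun_scale_def scaleR_fun_def smooth_near_mult)
  then show ?case
    using elim assms(1) subspace_tangent_space by (simp add: fun_scale_def subspace_scale)
qed

lemma section_near_sum:
  assumes "\<And>q. subspace (E q)" "\<And>i. i \<in> I \<Longrightarrow> section_near A E p (X i)"
  shows "section_near A E p (\<Sum>i\<in>I. X i)"
  using assms(2)
  by (induction I rule: infinite_finite_induct)
    (auto intro: section_near_add section_near_zero assms(1))

lemma section_near_minus:
  assumes "\<And>q. subspace (E q)" "section_near A E p X" "section_near A E p Y"
  shows "section_near A E p (X - Y)"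
proof -
  have "section_near A E p (X + fun_scale (\<lambda>q. - 1) Y)"
    by (intro section_near_add section_near_fun_scale assms smooth_near_const)
  moreover have "X + fun_scale (\<lambda>q. - 1) Y = X - Y" by (simp add: fun_eq_iff fun_scale_def)
  ultimately show ?thesis by simp
qed

lemma lie_bracket_apply:
  "smooth_near A p f \<Longrightarrow> lie_bracket A X Y p f = X p (\<lambda>q. Y q f) - Y p (\<lambda>q. X q f)"
  by (simp add: lie_bracket_def)

lemma lie_bracket_not_smooth: "\<not> smooth_near A p f \<Longrightarrow> lie_bracket A X Y p f = 0"
  by (simp add: lie_bracket_def)

text \<open>In \<open>X (Y (f * g))\<close> the products of first derivatives are symmetric in \<open>X\<close> and \<open>Y\<close>; they cancel
  in the commutator, which is therefore again a derivation.\<close>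

lemma lie_bracket_tangent:
  assumes X: "vfield_near A p X" and Y: "vfield_near A p Y"
  shows "lie_bracket A X Y p \<in> tangent_space A p"
proof -
  note Xp = section_near_in[OF X] and Yp = section_near_in[OF Y]
  show ?thesis
  proof (rule tangentI)
    fix f g
    assume f: "smooth_near A p f" and g: "smooth_near A p g"
    note fg = eventually_smooth_near[OF f] eventually_smooth_near[OF g]
    have add: "v (\<lambda>q. Z q (\<lambda>r. f r + g r)) = v (\<lambda>q. Z q f) + v (\<lambda>q. Z q g)"
      if v: "v \<in> tangent_space A p" and Z: "vfield_near A p Z" for v Z
    proof -
      have "\<forall>\<^sub>F q in nhds p. Z q f + Z q g = Z q (\<lambda>r. f r + g r)"
        using section_near_eventually_in[OF Z] fg by eventually_elim (simp add: tangent_add)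
      then have "v (\<lambda>q. Z q f + Z q g) = v (\<lambda>q. Z q (\<lambda>r. f r + g r))"
        by (intro tangent_cong[OF v] smooth_near_add section_near_smooth[OF Z] f g)
      then show ?thesis
        using f g section_near_smooth[OF Z] by (simp add: tangent_add[OF v])
    qed
    show "lie_bracket A X Y p (\<lambda>q. f q + g q) = lie_bracket A X Y p f + lie_bracket A X Y p g"
      using f g by (simp add: lie_bracket_apply smooth_near_add add[OF Xp Y] add[OF Yp X])
    have mult: "v (\<lambda>q. Z q (\<lambda>r. f r * g r)) =
        f p * v (\<lambda>q. Z q g) + Z p g * v f + (g p * v (\<lambda>q. Z q f) + Z p f * v g)"
      if v: "v \<in> tangent_space A p" and Z: "vfield_near A p Z" for v Z
    proof -
      have "\<forall>\<^sub>F q in nhds p. f q * Z q g + g q * Z q f = Z q (\<lambda>r. f r * g r)"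
        using section_near_eventually_in[OF Z] fg by eventually_elim (simp add: tangent_mult)
      then have "v (\<lambda>q. f q * Z q g + g q * Z q f) = v (\<lambda>q. Z q (\<lambda>r. f r * g r))"
        by (intro tangent_cong[OF v] smooth_near_add smooth_near_mult section_near_smooth[OF Z] f g)
      then show ?thesis
        using f g section_near_smooth[OF Z]
        by (simp add: tangent_add[OF v] tangent_mult[OF v] smooth_near_mult algebra_simps)
    qed
    show "lie_bracket A X Y p (\<lambda>q. f q * g q) =
        f p * lie_bracket A X Y p g + g p * lie_bracket A X Y p f"
      using f g
      by (simp add: lie_bracket_apply smooth_near_mult mult[OF Xp Y] mult[OF Yp X] algebra_simps)
  next
    fix c f
    assume f: "smooth_near A p f"
    have cmult: "v (\<lambda>q. Z q (\<lambda>r. c * f r)) = c * v (\<lambda>q. Z q f)"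
      if v: "v \<in> tangent_space A p" and Z: "vfield_near A p Z" for v Z
    proof -
      have "\<forall>\<^sub>F q in nhds p. c * Z q f = Z q (\<lambda>r. c * f r)"
        using section_near_eventually_in[OF Z] eventually_smooth_near[OF f]
        by eventually_elim (simp add: tangent_cmult)
      then have "v (\<lambda>q. c * Z q f) = v (\<lambda>q. Z q (\<lambda>r. c * f r))"
        by (intro tangent_cong[OF v] smooth_near_cmult section_near_smooth[OF Z] f)
      then show ?thesis
        using f section_near_smooth[OF Z] by (simp add: tangent_cmult[OF v])
    qed
    show "lie_bracket A X Y p (\<lambda>q. c * f q) = c * lie_bracket A X Y p f"
      using f by (simp add: lie_bracket_apply smooth_near_cmult cmult[OF Xp Y] cmult[OF Yp X]
          algebra_simps)
  next
    fix f g
    assume f: "smooth_near A p f" and eq: "\<forall>\<^sub>F q in nhds p. f q = g q"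
    have g: "smooth_near A p g" using f eq by (rule smooth_near_cong)
    have eq2: "\<forall>\<^sub>F q in nhds p. \<forall>\<^sub>F r in nhds q. f r = g r"
      using eq by (simp add: eventually_eventually)
    have cong: "v (\<lambda>q. Z q f) = v (\<lambda>q. Z q g)"
      if v: "v \<in> tangent_space A p" and Z: "vfield_near A p Z" for v Z
    proof (rule tangent_cong[OF v section_near_smooth[OF Z f]])
      show "\<forall>\<^sub>F q in nhds p. Z q f = Z q g"
        using section_near_eventually_in[OF Z] eventually_smooth_near[OF f] eq2
        by eventually_elim (rule tangent_cong)
    qed
    show "lie_bracket A X Y p f = lie_bracket A X Y p g"
      using f g by (simp add: lie_bracket_apply cong[OF Xp Y] cong[OF Yp X])
  qed (rule lie_bracket_not_smooth)
qed

lemma vfield_near_lie_bracket: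
  assumes "vfield_near A p X" "vfield_near A p Y"
  shows "vfield_near A p (lie_bracket A X Y)"
proof (rule vfield_nearI)
  note eventually = eventually_section_near[OF assms(1)] eventually_section_near[OF assms(2)]
  show "\<forall>\<^sub>F q in nhds p. lie_bracket A X Y q \<in> tangent_space A q"
    using eventually by eventually_elim (rule lie_bracket_tangent)
  show "\<forall>\<^sub>F q in nhds p. \<forall>f. smooth_near A q f \<longrightarrow> smooth_near A q (\<lambda>r. lie_bracket A X Y r f)"
    using eventually
  proof eventually_elim
    case (elim q)
    have "smooth_near A q (\<lambda>r. lie_bracket A X Y r f)" if f: "smooth_near A q f" for f
    proof (rule smooth_near_cong)
      show "smooth_near A q (\<lambda>r. X r (\<lambda>s. Y s f) - Y r (\<lambda>s. X s f))"
        by (intro smooth_near_diff section_near_smooth[OF elim(1)] section_near_smooth[OF elim(2)] f)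
      show "\<forall>\<^sub>F r in nhds q. X r (\<lambda>s. Y s f) - Y r (\<lambda>s. X s f) = lie_bracket A X Y r f"
        using eventually_smooth_near[OF f] by eventually_elim (simp add: lie_bracket_apply)
    qed
    then show ?case by blast
  qed
qed

lemma lie_bracket_antisym: "lie_bracket A X Y p = - lie_bracket A Y X p"
  by (simp add: lie_bracket_def fun_eq_iff)

lemma lie_bracket_add:
  assumes "vfield_near A p X" "vfield_near A p X'" "vfield_near A p Y"
  shows "lie_bracket A (X + X') Y p = lie_bracket A X Y p + lie_bracket A X' Y p"
proof
  fix f
  show "lie_bracket A (X + X') Y p f = (lie_bracket A X Y p + lie_bracket A X' Y p) f"
  proof (cases "smooth_near A p f")
    case True
    then show ?thesis
      using tangent_add[OF section_near_in[OF assms(3)] section_near_smooth[OF assms(1) True]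
          section_near_smooth[OF assms(2) True]]
      by (simp add: lie_bracket_apply)
  qed (simp add: lie_bracket_not_smooth)
qed

lemma lie_bracket_fun_scale:
  assumes "smooth_near A p f" "vfield_near A p X" "vfield_near A p Y"
  shows "lie_bracket A (fun_scale f X) Y p = f p *\<^sub>R lie_bracket A X Y p - Y p f *\<^sub>R X p"
proof
  fix h
  show "lie_bracket A (fun_scale f X) Y p h = (f p *\<^sub>R lie_bracket A X Y p - Y p f *\<^sub>R X p) h"
  proof (cases "smooth_near A p h")
    case True
    then show ?thesis
      using tangent_mult[OF section_near_in[OF assms(3)] assms(1) section_near_smooth[OF assms(2) True]]
      by (simp add: lie_bracket_apply fun_scale_def scaleR_fun_def algebra_simps)
  next
    case False
    then show ?thesis
      using tangent_not_smooth[OF section_near_in[OF assms(2)]]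
      by (simp add: lie_bracket_not_smooth scaleR_fun_def)
  qed
qed

lemma lie_bracket_cong:
  assumes "vfield_near A p X" "vfield_near A p Y"
    and "\<forall>\<^sub>F q in nhds p. X q = X' q" "\<forall>\<^sub>F q in nhds p. Y q = Y' q"
  shows "lie_bracket A X Y p = lie_bracket A X' Y' p"
proof
  fix f
  have "X p = X' p" "Y p = Y' p" using assms(3,4) eventually_nhds_x_imp_x by blast+
  moreover have "X p (\<lambda>q. Y q f) = X p (\<lambda>q. Y' q f)" if "smooth_near A p f"
    by (rule tangent_cong[OF section_near_in[OF assms(1)] section_near_smooth[OF assms(2) that]])
      (use assms(4) in eventually_elim, simp)
  moreover have "Y p (\<lambda>q. X q f) = Y p (\<lambda>q. X' q f)" if "smooth_near A p f"
    by (rule tangent_cong[OF section_near_in[OF assms(2)] section_near_smooth[OF assms(1) that]])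
      (use assms(3) in eventually_elim, simp)
  ultimately show "lie_bracket A X Y p f = lie_bracket A X' Y' p f"
    by (simp add: lie_bracket_def)
qed

end


section \<open>Extending a germ of a section to the whole manifold\<close>

context smooth_manifold
begin

text \<open>In a chart around \<open>p\<close> take \<open>flat 0 (r\<^sup>2 - \<bar>x\<bar>\<^sup>2)\<close>. Its support is the image of a closed ball, which is
  compact and hence closed because the manifold is Hausdorff; this makes the extension by zero smooth.\<close>

lemma bump_function:
  assumes "open S" "p \<in> S"
  obtains b K where "\<And>q. smooth_near A q b" "b p \<noteq> 0" "closed K" "K \<subseteq> S" "\<And>q. q \<notin> K \<Longrightarrow> b q = 0"
proof -
  obtain W \<phi> where W: "(W, \<phi>) \<in> A" "p \<in> W" by (rule chart_at)
  have "\<phi> p \<in> \<phi> ` (S \<inter> W)" using W(2) assms(2) by blast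
  then obtain r where r: "0 < r" "cball (\<phi> p) r \<subseteq> \<phi> ` (S \<inter> W)"
    using open_chart_image[OF W(1) assms(1)] unfolding open_contains_cball by blast
  define K where "K = inv_into W \<phi> ` cball (\<phi> p) r"
  define b where "b q = (if q \<in> W then flat 0 (r\<^sup>2 - (\<phi> q - \<phi> p) \<bullet> (\<phi> q - \<phi> p)) else 0)" for q
  have "continuous_on (cball (\<phi> p) r) (inv_into W \<phi>)"
    by (rule continuous_on_subset[OF homeomorphism_cont2[OF chartD(3)[OF W(1)]]]) (use r(2) in blast)
  then have K: "closed K"
    unfolding K_def by (intro compact_imp_closed compact_continuous_image compact_cball)
  have KS: "K \<subseteq> S" using r(2) chart_inv[OF W(1)] unfolding K_def by fastforce
  have b0: "b q = 0" if "q \<notin> K" for q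
  proof (rule ccontr)
    assume "b q \<noteq> 0"
    then have q: "q \<in> W" "(\<phi> q - \<phi> p) \<bullet> (\<phi> q - \<phi> p) < r\<^sup>2"
      by (auto simp: b_def flat_def split: if_splits)
    then have "norm (\<phi> q - \<phi> p) < r"
      using r(1) by (simp add: dot_square_norm power_less_imp_less_base)
    then have "\<phi> q \<in> cball (\<phi> p) r" by (simp add: dist_norm norm_minus_commute)
    then have "q \<in> K" unfolding K_def using chart_inv[OF W(1) q(1)] by force
    with that show False by blast
  qed
  have smooth: "smooth_near A q b" for q
  proof (cases "q \<in> W")
    case True
    show ?thesis
    proof (rule smooth_nearI_Ck_on[OF chartD(1)[OF W(1)] True])
      fix n W' \<phi>'
      assume W': "(W', \<phi>') \<in> A" and o: "open (\<phi>' ` (W \<inter> W'))"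
      have "Ck_on n (\<phi>' ` (W \<inter> W')) (\<lambda>x. \<phi> (inv_into W' \<phi>' x) + - \<phi> p)" for n
        by (intro Ck_on_add Ck_on_const o) (use chart_transition[OF W' W(1)] in \<open>simp add: Int_commute\<close>)
      then have tr: "Ck_on n (\<phi>' ` (W \<inter> W')) (\<lambda>x. \<phi> (inv_into W' \<phi>' x) - \<phi> p)" for n
        by simp
      have "Ck_on n (\<phi>' ` (W \<inter> W')) (\<lambda>x. r\<^sup>2 +
          (- 1) * ((\<phi> (inv_into W' \<phi>' x) - \<phi> p) \<bullet> (\<phi> (inv_into W' \<phi>' x) - \<phi> p)))"
        by (intro Ck_on_add Ck_on_mult Ck_on_const Ck_on_inner o tr)
      then have "Ck_on n (\<phi>' ` (W \<inter> W')) (\<lambda>x. r\<^sup>2 -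
          ((\<phi> (inv_into W' \<phi>' x) - \<phi> p) \<bullet> (\<phi> (inv_into W' \<phi>' x) - \<phi> p)))"
        by simp
      with o Ck_on_flat subset_UNIV have "Ck_on n (\<phi>' ` (W \<inter> W')) (\<lambda>x. flat 0 (r\<^sup>2 -
          ((\<phi> (inv_into W' \<phi>' x) - \<phi> p) \<bullet> (\<phi> (inv_into W' \<phi>' x) - \<phi> p))))"
        by (rule Ck_on_compose_real)
      then show "Ck_on n (\<phi>' ` (W \<inter> W')) (\<lambda>x. b (inv_into W' \<phi>' x))"
        by (rule Ck_on_transfer[OF o]) (use chart_inv[OF W'] in \<open>auto simp: b_def\<close>)
    qed
  next
    case False
    have "q \<in> - K" using False r(2) chart_inv[OF W(1)] unfolding K_def by fastforce
    then have "\<forall>\<^sub>F x in nhds q. 0 = b x"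
      using K b0 unfolding eventually_nhds by (intro exI[of _ "- K"]) auto
    then show ?thesis by (rule smooth_near_cong[OF smooth_near_const])
  qed
  have "b p \<noteq> 0" using r(1) W(2) by (simp add: b_def flat_def)
  then show thesis using that smooth K KS b0 by blast
qed

text \<open>Connections are maps of global sections, so testing them against a tangent vector of \<open>E\<close> requires a
  global section with that value.\<close>

lemma global_section_through:
  assumes E: "\<And>q. subspace (E q)" and X: "section_near A E p X"
  obtains Y where "Y \<in> \<Gamma> A E" "Y p = X p"
proof -
  obtain S where S: "open S" "p \<in> S" "\<And>q. q \<in> S \<Longrightarrow> section_near A E q X"
    using eventually_section_near[OF X] by (auto simp: eventually_nhds)
  obtain b K where b: "\<And>q. smooth_near A q b" "b p \<noteq> 0" "closed K" "K \<subseteq> S" "\<And>q. q \<notin> K \<Longrightarrow> b q = 0"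
    by (rule bump_function[OF S(1,2)]) blast
  define Y where "Y q = (if q \<in> S then (b q / b p) *\<^sub>R X q else 0)" for q
  have "section_near A E q Y" for q
  proof (cases "q \<in> S")
    case True
    have "section_near A E q (fun_scale (\<lambda>q. b q / b p) X)"
      by (intro section_near_fun_scale E S(3)[OF True] smooth_near_divide smooth_near_const b)
    moreover have "\<forall>\<^sub>F x in nhds q. fun_scale (\<lambda>q. b q / b p) X x = Y x"
      unfolding eventually_nhds using S(1) True by (auto simp: fun_scale_def Y_def)
    ultimately show ?thesis by (rule section_near_cong)
  next
    case False
    have "\<forall>\<^sub>F x in nhds q. 0 x = Y x"
      unfolding eventually_nhds
      using b(3-5) False by (intro exI[of _ "- K"]) (auto simp: Y_def)
    then show ?thesis by (rule section_near_cong[OF section_near_zero[OF E]])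
  qed
  then have "Y \<in> \<Gamma> A E" by (simp add: sections_iff_near)
  moreover have "Y p = X p" using S(2) b(2) by (simp add: Y_def)
  ultimately show thesis by (rule that)
qed

end


section \<open>Frames and smooth coefficients\<close>

lemma in_span_image_iff:
  fixes f :: "'i \<Rightarrow> 'v::real_vector"
  assumes "finite I"
  shows "v \<in> span (f ` I) \<longleftrightarrow> (\<exists>c. v = (\<Sum>i\<in>I. c i *\<^sub>R f i))"
proof
  assume "v \<in> span (f ` I)"
  then show "\<exists>c. v = (\<Sum>i\<in>I. c i *\<^sub>R f i)"
  proof (induction rule: span_induct_alt)
    case base
    show ?case by (rule exI[of _ "\<lambda>i. 0"]) simp
  next
    case (step r x y)
    then obtain i c where i: "i \<in> I" "x = f i" and y: "y = (\<Sum>i\<in>I. c i *\<^sub>R f i)" by blast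
    have "(\<Sum>j\<in>I. (c j + (if j = i then r else 0)) *\<^sub>R f j) =
        (\<Sum>j\<in>I. c j *\<^sub>R f j) + (\<Sum>j\<in>I. if j = i then r *\<^sub>R f j else 0)"
      by (simp add: scaleR_left_distrib sum.distrib if_distrib[of "\<lambda>c. c *\<^sub>R _"] cong: if_cong)
    also have "\<dots> = r *\<^sub>R x + y" using assms i y by (simp add: sum.delta)
    finally show ?case by metis
  qed
qed (auto intro!: span_sum span_scale intro: span_base)

text \<open>Unlike independence of the image set, this excludes repetitions among the \<open>v i\<close>.\<close>

definition independent_family :: "nat \<Rightarrow> (nat \<Rightarrow> 'v::real_vector) \<Rightarrow> bool" where
  "independent_family n v \<longleftrightarrow> (\<forall>c. (\<Sum>i<n. c i *\<^sub>R v i) = 0 \<longrightarrow> (\<forall>i<n. c i = 0))"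

lemma independent_familyD:
  "independent_family n v \<Longrightarrow> (\<Sum>i<n. c i *\<^sub>R v i) = 0 \<Longrightarrow> i < n \<Longrightarrow> c i = 0"
  unfolding independent_family_def by blast

lemma independent_family_Suc:
  assumes "independent_family (Suc n) v"
  shows "independent_family n v" "v n \<notin> span (v ` {..<n})"
proof -
  show "independent_family n v"
    unfolding independent_family_def
  proof (intro allI impI)
    fix c i
    assume "(\<Sum>i<n. c i *\<^sub>R v i) = 0" "i < n"
    then show "c i = 0"
      using independent_familyD[OF assms, of "c(n := 0)" i] by simp
  qed
  show "v n \<notin> span (v ` {..<n})"
  proof
    assume "v n \<in> span (v ` {..<n})"
    then obtain c where "v n = (\<Sum>i<n. c i *\<^sub>R v i)" by (auto simp: in_span_image_iff)
    then show False
      using independent_familyD[OF assms, of "c(n := - 1)" n] by simp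
  qed
qed

lemma independent_familyI:
  assumes "inj_on v {..<n}" "independent (v ` {..<n})"
  shows "independent_family n v"
  unfolding independent_family_def
proof (intro allI impI)
  fix c i
  assume *: "(\<Sum>i<n. c i *\<^sub>R v i) = 0" and i: "i < n"
  have "(\<Sum>x\<in>v ` {..<n}. c (the_inv_into {..<n} v x) *\<^sub>R x) = (\<Sum>i<n. c i *\<^sub>R v i)"
    using assms(1) by (subst sum.reindex) (auto simp: the_inv_into_f_f)
  then have "c (the_inv_into {..<n} v (v i)) = 0"
    using * i by (intro independentD[OF assms(2)]) auto
  then show "c i = 0" using assms(1) i by (simp add: the_inv_into_f_f)
qed

lemma sum_lessThan_add:
  fixes f :: "nat \<Rightarrow> 'b::comm_monoid_add"
  shows "(\<Sum>i<n + m. f i) = (\<Sum>i<n. f i) + (\<Sum>j<m. f (n + j))"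
  by (induction m) (simp_all add: add.assoc)

context smooth_manifold
begin

text \<open>Gaussian elimination. By independence \<open>Z n\<close> does not vanish at \<open>p\<close>, so some function \<open>f\<close> has
  \<open>Z n f \<noteq> 0\<close> near \<open>p\<close>; subtracting multiples of \<open>Z n\<close> so that all fields annihilate \<open>f\<close>
  removes the last coefficient without changing the others.\<close>

lemma smooth_coefficients:
  assumes "\<And>i. i < n \<Longrightarrow> vfield_near A p (Z i)" "vfield_near A p V"
    and "\<forall>\<^sub>F q in nhds p. V q = (\<Sum>i<n. a i q *\<^sub>R Z i q)"
    and "independent_family n (\<lambda>i. Z i p)" "i < n"
  shows "smooth_near A p (a i)"
  using assms
proof (induction n arbitrary: Z V i)
  case (Suc n)
  have "Z n p \<noteq> 0"
    using independent_family_Suc(2)[OF Suc.prems(4)] span_zero by metis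
  then obtain f where Znf: "Z n p f \<noteq> 0" by (auto simp: fun_eq_iff)
  have Zn: "vfield_near A p (Z n)" using Suc.prems(1) by blast
  have f: "smooth_near A p f" using Znf tangent_not_smooth[OF section_near_in[OF Zn]] by blast
  have Zf: "smooth_near A p (\<lambda>q. Z i q f)" if "i < Suc n" for i
    by (rule section_near_smooth[OF Suc.prems(1)[OF that] f])
  have nz: "\<forall>\<^sub>F q in nhds p. Z n q f \<in> - {0}"
    by (rule eventually_smooth_near_in[OF Zf]) (use Znf in auto)
  have Vf: "smooth_near A p (\<lambda>q. V q f)" by (rule section_near_smooth[OF Suc.prems(2) f])
  define r where "r i q = Z i q f / Z n q f" for i q
  define Z' where "Z' i = Z i - fun_scale (r i) (Z n)" for i
  define V' where "V' = V - fun_scale (\<lambda>q. V q f / Z n q f) (Z n)"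
  have IH: "smooth_near A p (a i)" if "i < n" for i
  proof (rule Suc.IH[OF _ _ _ _ that])
    show "vfield_near A p (Z' i)" if "i < n" for i
      unfolding Z'_def r_def
      by (intro section_near_minus section_near_fun_scale smooth_near_divide Zf Zn Suc.prems(1) Znf
          subspace_tangent_space) (use that in auto)
    show "vfield_near A p V'"
      unfolding V'_def
      by (intro section_near_minus section_near_fun_scale smooth_near_divide Zf Vf Zn Suc.prems(2) Znf
          subspace_tangent_space) auto
    show "\<forall>\<^sub>F q in nhds p. V' q = (\<Sum>i<n. a i q *\<^sub>R Z' i q)"
      using nz Suc.prems(3)
    proof eventually_elim
      case (elim q)
      have "V q f = (\<Sum>i<n. a i q * Z i q f) + a n q * Z n q f"
        using elim(2) by (simp add: sum_fun_apply scaleR_fun_def)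
      then have "V q f / Z n q f = (\<Sum>i<n. a i q * r i q) + a n q"
        using elim(1) by (simp add: r_def add_divide_distrib sum_divide_distrib)
      then have "V' q = V q - ((\<Sum>i<n. a i q * r i q) + a n q) *\<^sub>R Z n q"
        by (simp add: V'_def fun_scale_def)
      also have "\<dots> = (\<Sum>i<n. a i q *\<^sub>R Z i q) - (\<Sum>i<n. a i q * r i q) *\<^sub>R Z n q"
        unfolding elim(2) sum.lessThan_Suc scaleR_left_distrib by (rule add_diff_cancel_right)
      also have "\<dots> = (\<Sum>i<n. a i q *\<^sub>R Z' i q)"
        by (simp add: Z'_def fun_scale_def scaleR_sum_left sum_subtractf scaleR_right_diff_distrib)
      finally show ?case .
    qed
    show "independent_family n (\<lambda>i. Z' i p)"
      unfolding independent_family_def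
    proof (intro allI impI)
      fix c i
      assume c: "(\<Sum>i<n. c i *\<^sub>R Z' i p) = 0" and i: "i < n"
      have "(\<Sum>i<n. c i *\<^sub>R Z i p) - (\<Sum>i<n. c i * r i p) *\<^sub>R Z n p = (\<Sum>i<n. c i *\<^sub>R Z' i p)"
        by (simp add: Z'_def fun_scale_def scaleR_sum_left sum_subtractf scaleR_right_diff_distrib)
      then have "(\<Sum>j<Suc n. (c(n := - (\<Sum>i<n. c i * r i p))) j *\<^sub>R Z j p) = 0"
        using c by simp
      from independent_familyD[OF Suc.prems(4) this, of i] i show "c i = 0" by simp
    qed
  qed
  have "smooth_near A p (a n)"
  proof (rule smooth_near_cong)
    show "smooth_near A p (\<lambda>q. (V q f - (\<Sum>i<n. a i q * Z i q f)) / Z n q f)"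
      by (intro smooth_near_divide smooth_near_diff Vf smooth_near_sum smooth_near_mult IH Zf Znf) auto
    show "\<forall>\<^sub>F q in nhds p. (V q f - (\<Sum>i<n. a i q * Z i q f)) / Z n q f = a n q"
      using nz Suc.prems(3)
      by eventually_elim (simp add: sum_fun_apply scaleR_fun_def)
  qed
  then show ?case using IH Suc.prems(5) less_Suc_eq by metis
qed simp

lemma distribution_frame_near:
  assumes "distribution A k E"
  obtains X where "\<And>i. i < k \<Longrightarrow> section_near A E p (X i)"
    "\<forall>\<^sub>F q in nhds p. independent_family k (\<lambda>i. X i q) \<and> span ((\<lambda>i. X i q) ` {..<k}) = E q"
proof -
  obtain S X where S: "open S" "p \<in> S" "\<And>i. i < k \<Longrightarrow> vector_field_on A S (X i)"
    and X: "\<And>q. q \<in> S \<Longrightarrow> inj_on (\<lambda>i. X i q) {..<k} \<and> independent ((\<lambda>i. X i q) ` {..<k}) \<and>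
      span ((\<lambda>i. X i q) ` {..<k}) = E q"
    using assms unfolding distribution_def by metis
  have "X i \<in> sections A E S" if "i < k" for i
    using S(3)[OF that] X that unfolding sections_def by (auto intro: span_base)
  then have "section_near A E p (X i)" if "i < k" for i
    using S(1,2) sections_iff_near that by blast
  moreover have "\<forall>\<^sub>F q in nhds p. independent_family k (\<lambda>i. X i q) \<and> span ((\<lambda>i. X i q) ` {..<k}) = E q"
    unfolding eventually_nhds using S(1,2) X independent_familyI by (intro exI[of _ S]) blast
  ultimately show thesis by (rule that)
qed

lemma subspace_distribution: "distribution A k E \<Longrightarrow> subspace (E p)"
  unfolding distribution_def by (metis subspace_span)

end


section \<open>Metrics on subbundles and orthonormal frames\<close>

locale metric_bundle = smooth_manifold A
  for A :: "('a::{t2_space, second_countable_topology}, 'e::euclidean_space) atlas" +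
  fixes E :: "'a \<Rightarrow> 'a tvec set" and g :: "'a \<Rightarrow> 'a tvec \<Rightarrow> 'a tvec \<Rightarrow> real"
  assumes subspace_fiber: "subspace (E p)"
    and metric: "fiber_metric A E g"
begin

lemma metric_add_left:
  "u \<in> E p \<Longrightarrow> v \<in> E p \<Longrightarrow> w \<in> E p \<Longrightarrow> g p (u + v) w = g p u w + g p v w"
  using metric[unfolded fiber_metric_def, THEN conjunct1] by simp

lemma metric_scale_left: "u \<in> E p \<Longrightarrow> w \<in> E p \<Longrightarrow> g p (c *\<^sub>R u) w = c * g p u w"
  using metric[unfolded fiber_metric_def, THEN conjunct2, THEN conjunct1] by simp

lemma metric_sym: "u \<in> E p \<Longrightarrow> w \<in> E p \<Longrightarrow> g p u w = g p w u"
  using metric[unfolded fiber_metric_def, THEN conjunct2, THEN conjunct2, THEN conjunct1] by simp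

lemma metric_pos: "u \<in> E p \<Longrightarrow> u \<noteq> 0 \<Longrightarrow> 0 < g p u u"
  using metric[unfolded fiber_metric_def, THEN conjunct2, THEN conjunct2, THEN conjunct2, THEN conjunct1] by simp

lemma metric_add_right:
  "u \<in> E p \<Longrightarrow> v \<in> E p \<Longrightarrow> w \<in> E p \<Longrightarrow> g p w (u + v) = g p w u + g p w v"
  using metric_add_left[of u p v w] metric_sym[of w p "u + v"] metric_sym[of w p u] metric_sym[of w p v]
    subspace_add[OF subspace_fiber, of u p v] by simp

lemma metric_scale_right: "u \<in> E p \<Longrightarrow> w \<in> E p \<Longrightarrow> g p w (c *\<^sub>R u) = c * g p w u"
  using metric_scale_left[of u p w c] metric_sym[of w p "c *\<^sub>R u"] metric_sym[of w p u]
    subspace_scale[OF subspace_fiber, of u p c] by simp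

lemma metric_zero_left: "w \<in> E p \<Longrightarrow> g p 0 w = 0"
  using metric_scale_left[of 0 p w 0] subspace_0[OF subspace_fiber] by simp

lemma metric_diff_left:
  "u \<in> E p \<Longrightarrow> v \<in> E p \<Longrightarrow> w \<in> E p \<Longrightarrow> g p (u - v) w = g p u w - g p v w"
  using metric_add_left[of "u - v" p v w] subspace_diff[OF subspace_fiber, of u p v] by simp

lemma metric_sum_left:
  assumes "\<And>i. i \<in> I \<Longrightarrow> v i \<in> E p" "w \<in> E p"
  shows "g p (\<Sum>i\<in>I. v i) w = (\<Sum>i\<in>I. g p (v i) w)"
  using assms(1)
proof (induction I rule: infinite_finite_induct)
  case (insert i I)
  then have "g p (v i + sum v I) w = g p (v i) w + g p (sum v I) w"
    using assms(2) by (intro metric_add_left subspace_sum[OF subspace_fiber]) auto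
  then show ?case using insert by (simp del: plus_fun_apply)
qed (simp_all add: metric_zero_left assms(2))

lemma metric_combination_left:
  assumes "\<And>i. i \<in> I \<Longrightarrow> v i \<in> E p" "w \<in> E p"
  shows "g p (\<Sum>i\<in>I. c i *\<^sub>R v i) w = (\<Sum>i\<in>I. c i * g p (v i) w)"
proof -
  have "g p (\<Sum>i\<in>I. c i *\<^sub>R v i) w = (\<Sum>i\<in>I. g p (c i *\<^sub>R v i) w)"
    by (rule metric_sum_left) (use assms subspace_scale[OF subspace_fiber] in auto)
  also have "\<dots> = (\<Sum>i\<in>I. c i * g p (v i) w)"
    by (rule sum.cong) (use assms metric_scale_left in auto)
  finally show ?thesis .
qed

text \<open>Positive definiteness applied to \<open>u - v\<close>.\<close>

lemma metric_eqI:
  assumes "u \<in> E p" "v \<in> E p" "\<And>w. w \<in> E p \<Longrightarrow> g p u w = g p v w"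
  shows "u = v"
proof -
  have *: "u - v \<in> E p" using assms(1,2) subspace_diff[OF subspace_fiber] by blast
  have "g p (u - v) (u - v) = 0"
    using metric_diff_left[OF assms(1,2) *] assms(3)[OF *] by simp
  then have "u - v = 0" using metric_pos[OF *] less_irrefl by metis
  then show ?thesis by simp
qed

lemma smooth_near_metric:
  assumes "section_near A E p X" "section_near A E p Y"
  shows "smooth_near A p (\<lambda>q. g q (X q) (Y q))"
proof -
  have "\<forall>\<^sub>F q in nhds p. section_near A E q X \<and> section_near A E q Y"
    using assms by (intro eventually_conj eventually_section_near)
  then obtain S where S: "open S" "p \<in> S" "\<And>q. q \<in> S \<Longrightarrow> section_near A E q X \<and> section_near A E q Y"
    by (auto simp: eventually_nhds)
  then have "X \<in> sections A E S" "Y \<in> sections A E S" using sections_iff_near by blast+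
  then have "smooth_fun_on A S (\<lambda>q. g q (X q) (Y q))"
    using metric[unfolded fiber_metric_def, THEN conjunct2, THEN conjunct2, THEN conjunct2, THEN conjunct2]
      S(1) by blast
  then show ?thesis using S smooth_near_def by blast
qed

text \<open>The frames of the Gram-Schmidt induction, which do not yet span the fibres.\<close>

definition orthonormal_near :: "nat \<Rightarrow> 'a \<Rightarrow> (nat \<Rightarrow> 'a vfield) \<Rightarrow> bool" where
  "orthonormal_near n p Y \<longleftrightarrow>
     (\<forall>i<n. section_near A E p (Y i)) \<and>
     (\<forall>\<^sub>F q in nhds p. \<forall>i<n. \<forall>j<n. g q (Y i q) (Y j q) = (if i = j then 1 else 0))"

text \<open>The induction runs on germs. Independence at the points near \<open>p\<close> makes the component \<open>Z\<close> of the new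
  field orthogonal to the earlier ones nonzero there, so it can be normalized by the smooth factor
  \<open>g Z Z powr (- 1 / 2)\<close>; the spans agree because each step is triangular.\<close>

lemma gram_schmidt:
  assumes "\<And>i. i < n \<Longrightarrow> section_near A E p (X i)"
    and "\<forall>\<^sub>F q in nhds p. independent_family n (\<lambda>i. X i q)"
  shows "\<exists>Y. orthonormal_near n p Y \<and>
    (\<forall>\<^sub>F q in nhds p. span ((\<lambda>i. Y i q) ` {..<n}) = span ((\<lambda>i. X i q) ` {..<n}))"
  using assms
proof (induction n)
  case 0
  then show ?case by (auto simp: orthonormal_near_def)
next
  case (Suc n)
  have "\<forall>\<^sub>F q in nhds p. independent_family n (\<lambda>i. X i q)"
    using Suc.prems(2) by eventually_elim (rule independent_family_Suc(1))
  then obtain Y where Y: "orthonormal_near n p Y"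
    and span: "\<forall>\<^sub>F q in nhds p. span ((\<lambda>i. Y i q) ` {..<n}) = span ((\<lambda>i. X i q) ` {..<n})"
    using Suc.IH Suc.prems(1) less_Suc_eq by blast
  have Ys: "section_near A E p (Y i)" if "i < n" for i
    using Y that unfolding orthonormal_near_def by blast
  have Xn: "section_near A E p (X n)" using Suc.prems(1) by blast
  define c where "c i q = g q (X n q) (Y i q)" for i q
  define Z where "Z = X n - (\<Sum>i<n. fun_scale (c i) (Y i))"
  have Zq: "Z q = X n q - (\<Sum>i<n. c i q *\<^sub>R Y i q)" for q
    by (simp add: Z_def sum_fun_apply fun_scale_def)
  have Z: "section_near A E p Z"
    unfolding Z_def c_def
    by (intro section_near_minus section_near_sum section_near_fun_scale smooth_near_metric
        subspace_fiber Xn Ys) auto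
  define a where "a q = g q (Z q) (Z q)" for q
  define Yn where "Yn = fun_scale (\<lambda>q. a q powr (- 1 / 2)) Z"
  have Z0: "\<forall>\<^sub>F q in nhds p. Z q \<noteq> 0"
    using Suc.prems(2) span
  proof eventually_elim
    case (elim q)
    show ?case
    proof
      assume "Z q = 0"
      then have "X n q = (\<Sum>i<n. c i q *\<^sub>R Y i q)" using Zq[of q] by simp
      then have "X n q \<in> span ((\<lambda>i. Y i q) ` {..<n})" by (auto simp: in_span_image_iff)
      then show False using elim independent_family_Suc(2) by metis
    qed
  qed
  have a: "\<forall>\<^sub>F q in nhds p. 0 < a q"
    using section_near_eventually_in[OF Z] Z0
    by eventually_elim (simp add: a_def metric_pos)
  have Yns: "section_near A E p Yn"
    unfolding Yn_def
    by (intro section_near_fun_scale subspace_fiber Z smooth_near_powr eventually_nhds_x_imp_x[OF a])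
      (simp add: a_def smooth_near_metric Z)
  define Y' where "Y' = Y(n := Yn)"
  have Yin: "\<forall>\<^sub>F q in nhds p. \<forall>i<n. Y i q \<in> E q"
    using eventually_ball_finite[of "{..<n}" "\<lambda>q i. Y i q \<in> E q" "nhds p"]
      section_near_eventually_in[OF Ys] by (simp add: Ball_def)
  have on: "\<forall>\<^sub>F q in nhds p. \<forall>i<n. \<forall>j<n. g q (Y i q) (Y j q) = (if i = j then 1 else 0)"
    using Y unfolding orthonormal_near_def by blast
  have "\<forall>\<^sub>F q in nhds p. \<forall>i<Suc n. \<forall>j<Suc n. g q (Y' i q) (Y' j q) = (if i = j then 1 else 0)"
    using section_near_eventually_in[OF Z] section_near_eventually_in[OF Xn] Yin on a
  proof eventually_elim
    case (elim q)
    define s where "s = a q powr (- 1 / 2)"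
    have Ynq: "Yn q = s *\<^sub>R Z q" by (simp add: Yn_def fun_scale_def s_def)
    have "g q (\<Sum>i<n. c i q *\<^sub>R Y i q) (Y j q) = c j q" if "j < n" for j
    proof -
      have "g q (\<Sum>i<n. c i q *\<^sub>R Y i q) (Y j q) = (\<Sum>i<n. c i q * g q (Y i q) (Y j q))"
        by (rule metric_combination_left) (use elim(3) that in auto)
      also have "\<dots> = (\<Sum>i<n. if i = j then c i q else 0)"
        using elim(4) that by (intro sum.cong) auto
      finally show ?thesis using that by (simp add: sum.delta)
    qed
    then have "g q (Z q) (Y j q) = 0" if "j < n" for j
      unfolding Zq using elim(2,3) that subspace_scale[OF subspace_fiber]
      by (subst metric_diff_left) (auto intro!: subspace_sum[OF subspace_fiber] simp: c_def)
    then have orth: "g q (Yn q) (Y j q) = 0" "g q (Y j q) (Yn q) = 0" if "j < n" for j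
      using elim(1,3) that subspace_scale[OF subspace_fiber]
      by (simp_all add: Ynq metric_scale_left metric_scale_right metric_sym[of "Y j q"])
    have "g q (Yn q) (Yn q) = s * (s * a q)"
      using elim(1) subspace_scale[OF subspace_fiber]
      by (simp add: Ynq metric_scale_left metric_scale_right a_def)
    also have "\<dots> = (s * s) * a q" by simp
    also have "s * s = a q powr (- 1 / 2 + - 1 / 2)"
      unfolding s_def by (rule powr_add[symmetric])
    also have "\<dots> = inverse (a q)" using elim(5) by (simp add: powr_minus)
    finally have "g q (Yn q) (Yn q) = 1" using elim(5) by simp
    then show ?case using elim(4) orth by (auto simp: Y'_def less_Suc_eq)
  qed
  moreover have "section_near A E p (Y' i)" if "i < Suc n" for i
    using that Ys Yns by (auto simp: Y'_def less_Suc_eq)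
  moreover have "\<forall>\<^sub>F q in nhds p. span ((\<lambda>i. Y' i q) ` {..<Suc n}) = span ((\<lambda>i. X i q) ` {..<Suc n})"
    using span a
  proof eventually_elim
    case (elim q)
    define s where "s = a q powr (- 1 / 2)"
    have s: "s \<noteq> 0" using elim(2) by (simp add: s_def)
    have Ynq: "Yn q = s *\<^sub>R Z q" by (simp add: Yn_def fun_scale_def s_def)
    let ?X = "(\<lambda>i. X i q) ` {..<n}" and ?Y = "(\<lambda>i. Y i q) ` {..<n}"
    have images: "(\<lambda>i. Y' i q) ` {..<Suc n} = insert (Yn q) ?Y"
      "(\<lambda>i. X i q) ` {..<Suc n} = insert (X n q) ?X"
      by (auto simp: Y'_def lessThan_Suc)
    have sumY: "(\<Sum>i<n. c i q *\<^sub>R Y i q) \<in> span ?Y" by (auto simp: in_span_image_iff)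
    have mono: "span ?Y \<subseteq> span (insert (Yn q) ?Y)" "span ?X \<subseteq> span (insert (X n q) ?X)"
      by (intro span_mono; blast)+
    have "Z q \<in> span (insert (X n q) ?X)"
      unfolding Zq using sumY mono(2) elim(1) by (intro span_diff) (auto intro: span_base)
    then have 1: "Yn q \<in> span (insert (X n q) ?X)" unfolding Ynq by (rule span_scale)
    have "Z q = inverse s *\<^sub>R Yn q" using s by (simp add: Ynq)
    then have "Z q \<in> span (insert (Yn q) ?Y)" by (simp add: span_scale span_base)
    then have "Z q + (\<Sum>i<n. c i q *\<^sub>R Y i q) \<in> span (insert (Yn q) ?Y)"
      using sumY mono(1) by (intro span_add) auto
    then have 2: "X n q \<in> span (insert (Yn q) ?Y)" by (simp add: Zq)
    have "?Y \<subseteq> span (insert (X n q) ?X)" "?X \<subseteq> span (insert (Yn q) ?Y)"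
      using mono elim(1) span_superset[of ?X] span_superset[of ?Y] by blast+
    with 1 2 show ?case unfolding images span_eq by blast
  qed
  ultimately show ?case unfolding orthonormal_near_def by blast
qed

end


section \<open>The Koszul expression\<close>

text \<open>Twice \<open>g (D U V) W\<close> for the metric, torsion-free connection \<open>D\<close>, expressed without \<open>D\<close>.\<close>

definition koszul ::
  "('a \<Rightarrow> 'a tvec \<Rightarrow> 'a tvec \<Rightarrow> real) \<Rightarrow> ('a vfield \<Rightarrow> 'a vfield \<Rightarrow> 'a vfield)
    \<Rightarrow> 'a vfield \<Rightarrow> 'a vfield \<Rightarrow> 'a vfield \<Rightarrow> 'a \<Rightarrow> real" where
  "koszul g br U V W p =
     U p (\<lambda>q. g q (V q) (W q)) + V p (\<lambda>q. g q (U q) (W q)) - W p (\<lambda>q. g q (U q) (V q))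
     + g p (br U V p) (W p) - g p (br U W p) (V p) - g p (br V W p) (U p)"

context metric_bundle
begin

lemma global_section_in: "X \<in> \<Gamma> A E \<Longrightarrow> X p \<in> E p"
  unfolding sections_def by blast

text \<open>Replacing each derivative by the metric property and each bracket by the torsion, all terms cancel
  except \<open>2 * g (D U V) W\<close>. This determines \<open>D\<close> and serves both the connection on \<open>E\<close> and the
  Levi-Civita connection.\<close>

lemma koszul_identity:
  assumes D: "metric_torsion_free_connection A E g br D"
    and UVW: "U \<in> \<Gamma> A E" "V \<in> \<Gamma> A E" "W \<in> \<Gamma> A E"
  shows "2 * g p (D U V p) (W p) = koszul g br U V W p"
proof -
  have "D X Y \<in> \<Gamma> A E" if "X \<in> \<Gamma> A E" "Y \<in> \<Gamma> A E" for X Y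
    using D that unfolding metric_torsion_free_connection_def by simp
  then have DE: "D X Y p \<in> E p" if "X \<in> \<Gamma> A E" "Y \<in> \<Gamma> A E" for X Y
    using that global_section_in by blast
  have met: "X p (\<lambda>q. g q (Y q) (Z q)) = g p (D X Y p) (Z p) + g p (Y p) (D X Z p)"
    if "X \<in> \<Gamma> A E" "Y \<in> \<Gamma> A E" "Z \<in> \<Gamma> A E" for X Y Z
    using D that unfolding metric_torsion_free_connection_def by blast
  have "D X Y - D Y X = br X Y" if "X \<in> \<Gamma> A E" "Y \<in> \<Gamma> A E" for X Y
    using D that unfolding metric_torsion_free_connection_def by blast
  then have br: "br X Y p = D X Y p - D Y X p" if "X \<in> \<Gamma> A E" "Y \<in> \<Gamma> A E" for X Y
    using that by (metis minus_apply)
  note E = UVW[THEN global_section_in, of p]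
  show ?thesis
    unfolding koszul_def
    using UVW E DE
    by (simp add: met br metric_diff_left metric_sym[of "U p" p] metric_sym[of "V p" p])
qed

end


context metric_bundle
begin

lemma eventually_in_E:
  assumes "section_near A E p X" "section_near A E p Y"
  shows "\<forall>\<^sub>F q in nhds p. X q \<in> E q \<and> Y q \<in> E q"
  using assms by (intro eventually_conj section_near_eventually_in)

lemma derivative_metric_cong:
  assumes "v \<in> tangent_space A p" "section_near A E p X" "section_near A E p Y"
    and "\<forall>\<^sub>F q in nhds p. X q = X' q" "\<forall>\<^sub>F q in nhds p. Y q = Y' q"
  shows "v (\<lambda>q. g q (X q) (Y q)) = v (\<lambda>q. g q (X' q) (Y' q))"
  by (rule tangent_cong[OF assms(1) smooth_near_metric[OF assms(2,3)]])
    (use assms(4,5) in eventually_elim, simp)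

lemma derivative_metric_sym:
  assumes "v \<in> tangent_space A p" "section_near A E p X" "section_near A E p Y"
  shows "v (\<lambda>q. g q (X q) (Y q)) = v (\<lambda>q. g q (Y q) (X q))"
proof (rule tangent_cong[OF assms(1) smooth_near_metric[OF assms(2,3)]])
  show "\<forall>\<^sub>F q in nhds p. g q (X q) (Y q) = g q (Y q) (X q)"
    using eventually_in_E[OF assms(2,3)] by eventually_elim (blast intro: metric_sym)
qed

lemma derivative_metric_add:
  assumes v: "v \<in> tangent_space A p"
    and X: "section_near A E p X" and X': "section_near A E p X'" and Y: "section_near A E p Y"
  shows "v (\<lambda>q. g q ((X + X') q) (Y q)) = v (\<lambda>q. g q (X q) (Y q)) + v (\<lambda>q. g q (X' q) (Y q))"
proof -
  have "\<forall>\<^sub>F q in nhds p. g q ((X + X') q) (Y q) = g q (X q) (Y q) + g q (X' q) (Y q)"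
    using eventually_in_E[OF X Y] section_near_eventually_in[OF X']
    by eventually_elim (simp add: metric_add_left)
  then have "v (\<lambda>q. g q ((X + X') q) (Y q)) = v (\<lambda>q. g q (X q) (Y q) + g q (X' q) (Y q))"
    by (intro tangent_cong[OF v] smooth_near_metric section_near_add subspace_fiber X X' Y)
  then show ?thesis using tangent_add[OF v] smooth_near_metric X X' Y by simp
qed

lemma derivative_metric_fun_scale:
  assumes v: "v \<in> tangent_space A p" and f: "smooth_near A p f"
    and X: "section_near A E p X" and Y: "section_near A E p Y"
  shows "v (\<lambda>q. g q (fun_scale f X q) (Y q)) =
    f p * v (\<lambda>q. g q (X q) (Y q)) + g p (X p) (Y p) * v f"
proof -
  have "\<forall>\<^sub>F q in nhds p. g q (fun_scale f X q) (Y q) = f q * g q (X q) (Y q)"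
    using eventually_in_E[OF X Y] by eventually_elim (simp add: fun_scale_def metric_scale_left)
  then have "v (\<lambda>q. g q (fun_scale f X q) (Y q)) = v (\<lambda>q. f q * g q (X q) (Y q))"
    by (intro tangent_cong[OF v] smooth_near_metric section_near_fun_scale subspace_fiber f X Y)
  then show ?thesis using tangent_mult[OF v f] smooth_near_metric X Y by simp
qed

end

text \<open>The part of the calculus of Lie brackets that the Koszul expression uses. Projecting the bracket to a
  subbundle may destroy the Jacobi identity, but it preserves these rules.\<close>

locale metric_bracket = metric_bundle A E g
  for A :: "('a::{t2_space, second_countable_topology}, 'e::euclidean_space) atlas"
    and E :: "'a \<Rightarrow> 'a tvec set" and g :: "'a \<Rightarrow> 'a tvec \<Rightarrow> 'a tvec \<Rightarrow> real" +
  fixes br :: "'a vfield \<Rightarrow> 'a vfield \<Rightarrow> 'a vfield"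
  assumes section_near_br:
      "section_near A E p U \<Longrightarrow> section_near A E p V \<Longrightarrow> section_near A E p (br U V)"
    and br_antisym: "section_near A E p U \<Longrightarrow> section_near A E p V \<Longrightarrow> br U V p = - br V U p"
    and br_add_left: "section_near A E p U \<Longrightarrow> section_near A E p U' \<Longrightarrow> section_near A E p V \<Longrightarrow>
      br (U + U') V p = br U V p + br U' V p"
    and br_fun_scale_left: "smooth_near A p f \<Longrightarrow> section_near A E p U \<Longrightarrow> section_near A E p V \<Longrightarrow>
      br (fun_scale f U) V p = f p *\<^sub>R br U V p - V p f *\<^sub>R U p"
    and br_cong: "section_near A E p U \<Longrightarrow> section_near A E p V \<Longrightarrow>
      \<forall>\<^sub>F q in nhds p. U q = U' q \<Longrightarrow> \<forall>\<^sub>F q in nhds p. V q = V' q \<Longrightarrow> br U V p = br U' V' p"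
begin

abbreviation "K \<equiv> koszul g br"

lemma br_in: "section_near A E p U \<Longrightarrow> section_near A E p V \<Longrightarrow> br U V p \<in> E p"
  using section_near_br section_near_in by blast

lemma koszul_cong:
  assumes "section_near A E p U" "section_near A E p V" "section_near A E p W"
    and "\<forall>\<^sub>F q in nhds p. U q = U' q" "\<forall>\<^sub>F q in nhds p. V q = V' q" "\<forall>\<^sub>F q in nhds p. W q = W' q"
  shows "K U V W p = K U' V' W' p"
  using assms(1-3)[THEN tangent_of_section_near] assms(1-3) assms(4-6)
    assms(4-6)[THEN eventually_nhds_x_imp_x]
  unfolding koszul_def
  by (simp add: derivative_metric_cong[of "U' p" p V W V' W'] derivative_metric_cong[of "V' p" p U W U' W']
      derivative_metric_cong[of "W' p" p U V U' V'] br_cong[of p U V U' V'] br_cong[of p U W U' W']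
      br_cong[of p V W V' W'])

text \<open>Exchanging the last two arguments of the Koszul expression isolates the derivative of the metric,
  exchanging the first two the bracket. These are the metric property and the torsion of the connection
  that the expression defines.\<close>

lemma koszul_metric:
  assumes "section_near A E p U" "section_near A E p V" "section_near A E p W"
  shows "K U V W p + K U W V p = 2 * U p (\<lambda>q. g q (V q) (W q))"
proof -
  note T = assms[THEN tangent_of_section_near] and E = assms[THEN section_near_in]
  have "g p (br W V p) (U p) = - g p (br V W p) (U p)"
    using br_antisym[OF assms(3,2)] metric_scale_left[of "br V W p" p "U p" "- 1"]
      br_in[OF assms(2,3)] E(1) by simp
  then show ?thesis
    unfolding koszul_def
    using derivative_metric_sym[OF T(1) assms(2,3)] derivative_metric_sym[OF T(2) assms(1,3)]
    by simp
qed

lemma koszul_torsion: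
  assumes "section_near A E p U" "section_near A E p V" "section_near A E p W"
  shows "K U V W p - K V U W p = 2 * g p (br U V p) (W p)"
proof -
  note T = assms[THEN tangent_of_section_near] and E = assms[THEN section_near_in]
  have "g p (br V U p) (W p) = - g p (br U V p) (W p)"
    using br_antisym[OF assms(2,1)] metric_scale_left[of "br U V p" p "W p" "- 1"]
      br_in[OF assms(1,2)] E(3) by simp
  then show ?thesis
    unfolding koszul_def using derivative_metric_sym[OF T(3) assms(1,2)] by simp
qed

lemma koszul_add_1:
  assumes "section_near A E p U" "section_near A E p U'" "section_near A E p V" "section_near A E p W"
  shows "K (U + U') V W p = K U V W p + K U' V W p"
proof -
  note T = assms[THEN tangent_of_section_near] and E = assms[THEN section_near_in]
  have "g p (br V W p) (U p + U' p) = g p (br V W p) (U p) + g p (br V W p) (U' p)"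
    by (intro metric_add_right E br_in assms)
  moreover have "g p (br (U + U') V p) (W p) = g p (br U V p) (W p) + g p (br U' V p) (W p)"
    unfolding br_add_left[OF assms(1,2,3)] by (intro metric_add_left E br_in assms)
  moreover have "g p (br (U + U') W p) (V p) = g p (br U W p) (V p) + g p (br U' W p) (V p)"
    unfolding br_add_left[OF assms(1,2,4)] by (intro metric_add_left E br_in assms)
  ultimately show ?thesis
    unfolding koszul_def
    using derivative_metric_add[OF T(3) assms(1,2,4)] derivative_metric_add[OF T(4) assms(1,2,3)]
    by simp
qed

text \<open>The derivatives of \<open>f\<close> that come from the metric terms cancel those that come from the brackets.\<close>

lemma koszul_fun_scale_1:
  assumes f: "smooth_near A p f"
    and UVW: "section_near A E p U" "section_near A E p V" "section_near A E p W"
  shows "K (fun_scale f U) V W p = f p * K U V W p"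
proof -
  note T = UVW[THEN tangent_of_section_near] and E = UVW[THEN section_near_in]
  have br: "g p (br (fun_scale f U) X p) (Y p) = f p * g p (br U X p) (Y p) - X p f * g p (U p) (Y p)"
    if X: "section_near A E p X" and Y: "section_near A E p Y" for X Y
    unfolding br_fun_scale_left[OF f UVW(1) X]
    using br_in[OF UVW(1) X] E(1) section_near_in[OF Y] subspace_scale[OF subspace_fiber]
    by (simp add: metric_diff_left metric_scale_left)
  have "g p (br V W p) (fun_scale f U p) = f p * g p (br V W p) (U p)"
    unfolding fun_scale_def by (intro metric_scale_right E br_in UVW)
  then show ?thesis
    unfolding koszul_def
    using derivative_metric_fun_scale[OF T(2) f UVW(1,3)] derivative_metric_fun_scale[OF T(3) f UVW(1,2)]
      br[OF UVW(2,3)] br[OF UVW(3,2)]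
    by (simp add: fun_scale_def scaleR_fun_def algebra_simps)
qed

text \<open>In the other two slots the behaviour under sums and products follows from the first slot, since
  the metric and torsion identities exchange the slots.\<close>

lemma koszul_add_2:
  assumes "section_near A E p U" "section_near A E p V" "section_near A E p V'" "section_near A E p W"
  shows "K U (V + V') W p = K U V W p + K U V' W p"
proof -
  note sum = section_near_add[OF subspace_fiber assms(2,3)]
  have "br U (V + V') p = br U V p + br U V' p"
    using br_antisym[OF assms(1) sum] br_add_left[OF assms(2,3,1)]
      br_antisym[OF assms(1,2)] br_antisym[OF assms(1,3)] by simp
  then have "g p (br U (V + V') p) (W p) = g p (br U V p) (W p) + g p (br U V' p) (W p)"
    using metric_add_left[OF br_in[OF assms(1,2)] br_in[OF assms(1,3)] section_near_in[OF assms(4)]]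
    by simp
  then show ?thesis
    using koszul_torsion[OF assms(1) sum assms(4)] koszul_torsion[OF assms(1,2,4)]
      koszul_torsion[OF assms(1,3,4)] koszul_add_1[OF assms(2,3,1,4)] by simp
qed

lemma koszul_fun_scale_2:
  assumes f: "smooth_near A p f"
    and UVW: "section_near A E p U" "section_near A E p V" "section_near A E p W"
  shows "K U (fun_scale f V) W p = f p * K U V W p + 2 * (U p f * g p (V p) (W p))"
proof -
  note fV = section_near_fun_scale[OF subspace_fiber f UVW(2)] and E = UVW[THEN section_near_in]
  have "g p (br (fun_scale f V) U p) (W p) = f p * g p (br V U p) (W p) - U p f * g p (V p) (W p)"
    unfolding br_fun_scale_left[OF f UVW(2,1)]
    using br_in[OF UVW(2,1)] E subspace_scale[OF subspace_fiber]
    by (simp add: metric_diff_left metric_scale_left)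
  then show ?thesis
    using koszul_torsion[OF fV UVW(1,3)] koszul_torsion[OF UVW(2,1,3)]
      koszul_fun_scale_1[OF f UVW(2,1,3)] by (simp add: algebra_simps)
qed

lemma koszul_add_3:
  assumes "section_near A E p U" "section_near A E p V" "section_near A E p W" "section_near A E p W'"
  shows "K U V (W + W') p = K U V W p + K U V W' p"
proof -
  note sum = section_near_add[OF subspace_fiber assms(3,4)]
  note T = tangent_of_section_near[OF assms(1)]
  show ?thesis
    using koszul_metric[OF assms(1) sum assms(2)] koszul_metric[OF assms(1,3,2)]
      koszul_metric[OF assms(1,4,2)] koszul_add_2[OF assms(1,3,4,2)]
      derivative_metric_add[OF T assms(3,4,2)] by simp
qed

lemma koszul_fun_scale_3:
  assumes f: "smooth_near A p f"
    and UVW: "section_near A E p U" "section_near A E p V" "section_near A E p W"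
  shows "K U V (fun_scale f W) p = f p * K U V W p"
proof -
  note fW = section_near_fun_scale[OF subspace_fiber f UVW(3)]
  have "f p * K U V W p = f p * (2 * U p (\<lambda>q. g q (W q) (V q))) - f p * K U W V p"
    using koszul_metric[OF UVW(1,3,2)] by (simp add: right_diff_distrib[symmetric])
  then show ?thesis
    using koszul_metric[OF UVW(1) fW UVW(2)]
      koszul_fun_scale_2[OF f UVW(1,3,2)]
      derivative_metric_fun_scale[OF tangent_of_section_near[OF UVW(1)] f UVW(3,2)]
    by (simp add: algebra_simps)
qed

lemma section_near_combination:
  fixes n :: nat
  assumes "\<And>i. i < n \<Longrightarrow> smooth_near A p (f i)" "\<And>i. i < n \<Longrightarrow> section_near A E p (X i)"
  shows "section_near A E p (\<Sum>i<n. fun_scale (f i) (X i))"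
  using assms by (intro section_near_sum section_near_fun_scale subspace_fiber) auto

lemma koszul_zero:
  assumes "section_near A E p U" "section_near A E p V"
  shows "K 0 U V p = 0" "K U 0 V p = 0" "K U V 0 p = 0"
proof -
  note zero = section_near_zero[OF subspace_fiber]
  show "K 0 U V p = 0" using koszul_add_1[OF zero zero assms] by simp
  show "K U 0 V p = 0" using koszul_add_2[OF assms(1) zero zero assms(2)] by simp
  show "K U V 0 p = 0" using koszul_add_3[OF assms zero zero] by simp
qed

lemma koszul_combination:
  fixes n :: nat
  assumes f: "\<And>i. i < n \<Longrightarrow> smooth_near A p (f i)" and X: "\<And>i. i < n \<Longrightarrow> section_near A E p (X i)"
    and U: "section_near A E p U" and V: "section_near A E p V"
  shows "K (\<Sum>i<n. fun_scale (f i) (X i)) U V p = (\<Sum>i<n. f i p * K (X i) U V p)" (is "?A n")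
    and "K U (\<Sum>i<n. fun_scale (f i) (X i)) V p =
      (\<Sum>i<n. f i p * K U (X i) V p + 2 * (U p (f i) * g p (X i p) (V p)))" (is "?B n")
    and "K U V (\<Sum>i<n. fun_scale (f i) (X i)) p = (\<Sum>i<n. f i p * K U V (X i) p)" (is "?C n")
proof -
  have S: "section_near A E p (\<Sum>i<m. fun_scale (f i) (X i))" if "m < n" for m
    by (rule section_near_combination) (use f X that in auto)
  note Y = section_near_fun_scale[OF subspace_fiber f X]
  have "?A m" if "m \<le> n" for m
    using that
  proof (induction m)
    case (Suc m)
    then have m: "m < n" by simp
    then show ?case
      using Suc.IH koszul_add_1[OF S[OF m] Y[OF m m] U V] koszul_fun_scale_1[OF f[OF m] X[OF m] U V]
      by (simp del: plus_fun_apply)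
  qed (simp add: koszul_zero[OF U V])
  then show "?A n" by simp
  have "?B m" if "m \<le> n" for m
    using that
  proof (induction m)
    case (Suc m)
    then have m: "m < n" by simp
    then show ?case
      using Suc.IH koszul_add_2[OF U S[OF m] Y[OF m m] V] koszul_fun_scale_2[OF f[OF m] U X[OF m] V]
      by (simp del: plus_fun_apply)
  qed (simp add: koszul_zero[OF U V])
  then show "?B n" by simp
  have "?C m" if "m \<le> n" for m
    using that
  proof (induction m)
    case (Suc m)
    then have m: "m < n" by simp
    then show ?case
      using Suc.IH koszul_add_3[OF U V S[OF m] Y[OF m m]] koszul_fun_scale_3[OF f[OF m] U V X[OF m]]
      by (simp del: plus_fun_apply)
  qed (simp add: koszul_zero[OF U V])
  then show "?C n" by simp
qed

lemma smooth_near_koszul: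
  assumes "section_near A E p U" "section_near A E p V" "section_near A E p W"
  shows "smooth_near A p (\<lambda>q. K U V W q)"
  unfolding koszul_def
  by (intro smooth_near_add smooth_near_diff section_near_smooth[OF assms(1)]
      section_near_smooth[OF assms(2)] section_near_smooth[OF assms(3)] smooth_near_metric
      section_near_br assms)

end


section \<open>The projected Lie bracket\<close>

locale complementary_distributions = smooth_manifold A
  for A :: "('a::{t2_space, second_countable_topology}, 'e::euclidean_space) atlas" +
  fixes k m :: nat and E F :: "'a \<Rightarrow> 'a tvec set"
  assumes distribution_E: "distribution A k E"
    and distribution_F: "distribution A m F"
    and complementary: "complementary A E F"
begin

lemma subspace_E: "subspace (E p)" and subspace_F: "subspace (F p)"
  by (rule subspace_distribution[OF distribution_E], rule subspace_distribution[OF distribution_F])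

lemma sum_E_F: "{u + w | u w. u \<in> E p \<and> w \<in> F p} = tangent_space A p"
  and Int_E_F: "E p \<inter> F p = {0}"
  using complementary[unfolded complementary_def, rule_format, of p] by (simp_all only:)

lemma tangent_decomposition:
  assumes "v \<in> tangent_space A p"
  obtains u w where "u \<in> E p" "w \<in> F p" "v = u + w"
  using assms unfolding sum_E_F[symmetric] by blast

lemma E_tangent:
  assumes "u \<in> E p"
  shows "u \<in> tangent_space A p"
proof -
  have "u = u + 0" by simp
  then show ?thesis
    unfolding sum_E_F[symmetric] using assms subspace_0[OF subspace_F] by blast
qed

lemma E_Int_F: "u \<in> E p \<Longrightarrow> u \<in> F p \<Longrightarrow> u = 0"
  using Int_E_F by blast

text \<open>The decomposition \<open>X p = u + w\<close> is unique because \<open>E\<close> and \<open>F\<close> meet in zero only.\<close>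

lemma hproj_eqI:
  assumes "u \<in> E p" "w \<in> F p" "X p = u + w"
  shows "hproj E F X p = u"
  unfolding hproj_def
proof (rule the_equality)
  show "u \<in> E p \<and> (\<exists>w\<in>F p. X p = u + w)" using assms by blast
  fix u'
  assume "u' \<in> E p \<and> (\<exists>w\<in>F p. X p = u' + w)"
  then obtain w' where u': "u' \<in> E p" "w' \<in> F p" "u + w = u' + w'" using assms(3) by auto
  have "u' - u = w - w'" using u'(3) by (simp add: algebra_simps)
  then have "u' - u \<in> F p" using subspace_diff[OF subspace_F assms(2) u'(2)] by simp
  then have "u' - u = 0" using subspace_diff[OF subspace_E u'(1) assms(1)] E_Int_F by blast
  then show "u' = u" by simp
qed

lemma hproj_decomposition:
  assumes "X p \<in> tangent_space A p"
  obtains w where "hproj E F X p \<in> E p" "w \<in> F p" "X p = hproj E F X p + w"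
proof -
  obtain u w where uw: "u \<in> E p" "w \<in> F p" "X p = u + w"
    using assms by (rule tangent_decomposition)
  then have "hproj E F X p = u" by (rule hproj_eqI)
  with uw show thesis using that by blast
qed

lemma hproj_linear:
  assumes "X p \<in> tangent_space A p" "Y p \<in> tangent_space A p" "Z p = a *\<^sub>R X p + b *\<^sub>R Y p"
  shows "hproj E F Z p = a *\<^sub>R hproj E F X p + b *\<^sub>R hproj E F Y p"
proof -
  obtain x where x: "hproj E F X p \<in> E p" "x \<in> F p" "X p = hproj E F X p + x"
    using assms(1) by (rule hproj_decomposition)
  obtain y where y: "hproj E F Y p \<in> E p" "y \<in> F p" "Y p = hproj E F Y p + y"
    using assms(2) by (rule hproj_decomposition)
  have "Z p = a *\<^sub>R (hproj E F X p + x) + b *\<^sub>R (hproj E F Y p + y)"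
    by (simp only: x(3)[symmetric] y(3)[symmetric] assms(3))
  also have "\<dots> = (a *\<^sub>R hproj E F X p + b *\<^sub>R hproj E F Y p) + (a *\<^sub>R x + b *\<^sub>R y)"
    by (simp only: scaleR_add_right add_ac)
  finally show ?thesis
    using x y by (intro hproj_eqI[where w = "a *\<^sub>R x + b *\<^sub>R y"])
      (auto intro!: subspace_add subspace_scale subspace_E subspace_F)
qed

lemma hproj_ident: "X p \<in> E p \<Longrightarrow> hproj E F X p = X p"
  by (rule hproj_eqI[where w = 0]) (simp_all add: subspace_0[OF subspace_F])

lemma hproj_cong: "X p = Y p \<Longrightarrow> hproj E F X p = hproj E F Y p"
  unfolding hproj_def by (simp only:)

text \<open>Local frames of \<open>E\<close> and \<open>F\<close> together form a frame of the tangent bundle; the projection keeps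
  the coefficients that belong to \<open>E\<close>, and these are smooth.\<close>

lemma section_near_hproj:
  assumes V: "vfield_near A p V"
  shows "section_near A E p (hproj E F V)"
proof -
  obtain X where X: "\<And>i. i < k \<Longrightarrow> section_near A E p (X i)"
    "\<forall>\<^sub>F q in nhds p. independent_family k (\<lambda>i. X i q) \<and> span ((\<lambda>i. X i q) ` {..<k}) = E q"
    by (rule distribution_frame_near[OF distribution_E, of p]) blast
  obtain Y where Y: "\<And>i. i < m \<Longrightarrow> section_near A F p (Y i)"
    "\<forall>\<^sub>F q in nhds p. independent_family m (\<lambda>i. Y i q) \<and> span ((\<lambda>i. Y i q) ` {..<m}) = F q"
    by (rule distribution_frame_near[OF distribution_F, of p]) blast
  define Z where "Z i = (if i < k then X i else Y (i - k))" for i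
  have split: "(\<Sum>i<k + m. c i *\<^sub>R Z i q) = (\<Sum>i<k. c i *\<^sub>R X i q) + (\<Sum>j<m. c (k + j) *\<^sub>R Y j q)" for c q
    by (simp add: sum_lessThan_add Z_def)
  \<comment> \<open>The coefficients are chosen point by point; their smoothness is a consequence, not a choice.\<close>
  define a where "a i q = (SOME c. V q = (\<Sum>i<k + m. c i *\<^sub>R Z i q)) i" for i q
  have ev: "\<forall>\<^sub>F q in nhds p. V q = (\<Sum>i<k + m. a i q *\<^sub>R Z i q) \<and>
      hproj E F V q = (\<Sum>i<k. a i q *\<^sub>R X i q)"
    using section_near_eventually_in[OF V] X(2) Y(2)
  proof eventually_elim
    case (elim q)
    obtain u w where uw: "u \<in> E q" "w \<in> F q" "V q = u + w"
      using elim(1) by (rule tangent_decomposition)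
    obtain c where c: "u = (\<Sum>i<k. c i *\<^sub>R X i q)"
      using uw(1) elim(2) in_span_image_iff[of "{..<k}" u "\<lambda>i. X i q"] by auto
    obtain d where d: "w = (\<Sum>i<m. d i *\<^sub>R Y i q)"
      using uw(2) elim(3) in_span_image_iff[of "{..<m}" w "\<lambda>i. Y i q"] by auto
    have "V q = (\<Sum>i<k + m. (if i < k then c i else d (i - k)) *\<^sub>R Z i q)"
      unfolding split uw(3) c d by simp
    then have Vq: "V q = (\<Sum>i<k + m. a i q *\<^sub>R Z i q)"
      unfolding a_def
      by (rule someI[where P = "\<lambda>c. V q = (\<Sum>i<k + m. c i *\<^sub>R Z i q)"])
    moreover have "hproj E F V q = (\<Sum>i<k. a i q *\<^sub>R X i q)"
    proof (rule hproj_eqI)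
      show "(\<Sum>i<k. a i q *\<^sub>R X i q) \<in> E q"
        using elim(2) in_span_image_iff[of "{..<k}" _ "\<lambda>i. X i q"] by auto
      show "(\<Sum>j<m. a (k + j) q *\<^sub>R Y j q) \<in> F q"
        using elim(3) in_span_image_iff[of "{..<m}" _ "\<lambda>i. Y i q"] by auto
      show "V q = (\<Sum>i<k. a i q *\<^sub>R X i q) + (\<Sum>j<m. a (k + j) q *\<^sub>R Y j q)"
        using Vq split[of "\<lambda>i. a i q" q] by simp
    qed
    ultimately show ?case by blast
  qed
  have Zs: "vfield_near A p (Z i)" if "i < k + m" for i
    using that X(1)[THEN section_near_tangent] Y(1)[THEN section_near_tangent]
    by (auto simp: Z_def)
  have "independent_family (k + m) (\<lambda>i. Z i p)"
    unfolding independent_family_def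
  proof (intro allI impI)
    fix c i
    assume sum0: "(\<Sum>i<k + m. c i *\<^sub>R Z i p) = 0" and i: "i < k + m"
    note Xp = eventually_nhds_x_imp_x[OF X(2)] and Yp = eventually_nhds_x_imp_x[OF Y(2)]
    let ?u = "\<Sum>i<k. c i *\<^sub>R X i p" and ?w = "\<Sum>j<m. c (k + j) *\<^sub>R Y j p"
    have u: "?u \<in> E p" using Xp in_span_image_iff[of "{..<k}" _ "\<lambda>i. X i p"] by auto
    have w: "?w \<in> F p" using Yp in_span_image_iff[of "{..<m}" _ "\<lambda>i. Y i p"] by auto
    have "?u + ?w = 0" using sum0 split by simp
    then have "?u = - ?w" by (rule eq_neg_iff_add_eq_0[THEN iffD2])
    then have "?u = 0" using u subspace_neg[OF subspace_F w] E_Int_F by metis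
    moreover from this have "?w = 0" using \<open>?u + ?w = 0\<close> by simp
    ultimately show "c i = 0"
      using independent_familyD[of k "\<lambda>i. X i p" c i] i Xp Yp
        independent_familyD[of m "\<lambda>i. Y i p" "\<lambda>j. c (k + j)" "i - k"]
      by (cases "i < k") auto
  qed
  then have a: "smooth_near A p (a i)" if "i < k + m" for i
    using ev Zs V that by (intro smooth_coefficients[of "k + m" p Z V]) (auto elim: eventually_mono)
  have "section_near A E p (\<Sum>i<k. fun_scale (a i) (X i))"
    by (intro section_near_sum section_near_fun_scale subspace_E a X(1)) auto
  moreover have "\<forall>\<^sub>F q in nhds p. (\<Sum>i<k. fun_scale (a i) (X i)) q = hproj E F V q"
    using ev by eventually_elim (simp add: sum_fun_apply fun_scale_def)
  ultimately show ?thesis by (rule section_near_cong)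
qed

end

locale sub_riemannian_splitting = complementary_distributions A k m E F
  for A :: "('a::{t2_space, second_countable_topology}, 'e::euclidean_space) atlas"
    and k m :: nat and E F :: "'a \<Rightarrow> 'a tvec set" +
  fixes g :: "'a \<Rightarrow> 'a tvec \<Rightarrow> 'a tvec \<Rightarrow> real"
  assumes metric_E: "fiber_metric A E g"

sublocale sub_riemannian_splitting \<subseteq> metric_bracket A E g "\<lambda>U V. hproj E F (lie_bracket A U V)"
proof
  show "subspace (E p)" for p by (rule subspace_E)
  show "fiber_metric A E g" by (rule metric_E)
next
  fix p U V
  assume UV: "section_near A E p U" "section_near A E p V"
  note T = UV[THEN section_near_tangent]
  show "section_near A E p (hproj E F (lie_bracket A U V))"
    by (intro section_near_hproj vfield_near_lie_bracket T)
  show "hproj E F (lie_bracket A U V) p = - hproj E F (lie_bracket A V U) p"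
    using hproj_linear[of "lie_bracket A V U" p "lie_bracket A V U" "lie_bracket A U V" "- 1" 0]
      lie_bracket_tangent[OF T(2,1)] lie_bracket_antisym[of U V p] by simp
next
  fix p U U' V
  assume "section_near A E p U" "section_near A E p U'" "section_near A E p V"
  note T = this[THEN section_near_tangent]
  show "hproj E F (lie_bracket A (U + U') V) p =
      hproj E F (lie_bracket A U V) p + hproj E F (lie_bracket A U' V) p"
    using hproj_linear[of "lie_bracket A U V" p "lie_bracket A U' V" "lie_bracket A (U + U') V" 1 1]
      lie_bracket_tangent[OF T(1,3)] lie_bracket_tangent[OF T(2,3)] lie_bracket_add[OF T]
    by (simp del: plus_fun_apply)
next
  fix p f U V
  assume f: "smooth_near A p f" and UV: "section_near A E p U" "section_near A E p V"
  note T = UV[THEN section_near_tangent]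
  show "hproj E F (lie_bracket A (fun_scale f U) V) p =
      f p *\<^sub>R hproj E F (lie_bracket A U V) p - V p f *\<^sub>R U p"
    using hproj_linear[of "lie_bracket A U V" p U "lie_bracket A (fun_scale f U) V" "f p" "- V p f"]
      lie_bracket_tangent[OF T] section_near_in[OF T(1)] lie_bracket_fun_scale[OF f T]
      hproj_ident[of U p, OF section_near_in[OF UV(1)]] by (simp del: plus_fun_apply)
next
  fix p U V U' V'
  assume "section_near A E p U" "section_near A E p V"
    and eq: "\<forall>\<^sub>F q in nhds p. U q = U' q" "\<forall>\<^sub>F q in nhds p. V q = V' q"
  note T = this(1,2)[THEN section_near_tangent]
  show "hproj E F (lie_bracket A U V) p = hproj E F (lie_bracket A U' V') p"
    by (intro hproj_cong lie_bracket_cong T eq)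
qed


section \<open>The frame connection satisfies the Koszul identity\<close>

lemma sum_rotate:
  "(\<Sum>i\<in>A. \<Sum>j\<in>B. \<Sum>l\<in>C. f i j l) = (\<Sum>l\<in>C. \<Sum>i\<in>A. \<Sum>j\<in>B. f i j l)"
proof -
  have "(\<Sum>i\<in>A. \<Sum>j\<in>B. \<Sum>l\<in>C. f i j l) = (\<Sum>i\<in>A. \<Sum>l\<in>C. \<Sum>j\<in>B. f i j l)"
    by (intro sum.cong refl sum.swap)
  also have "\<dots> = (\<Sum>l\<in>C. \<Sum>i\<in>A. \<Sum>j\<in>B. f i j l)" by (rule sum.swap)
  finally show ?thesis .
qed

context sub_riemannian_splitting
begin

lemma frame_section_near:
  "orthonormal_frame A k E g S X \<Longrightarrow> p \<in> S \<Longrightarrow> i < k \<Longrightarrow> section_near A E p (X i)"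
  unfolding orthonormal_frame_def using sections_iff_near by blast

lemma frame_eventually: "orthonormal_frame A k E g S X \<Longrightarrow> p \<in> S \<Longrightarrow> \<forall>\<^sub>F q in nhds p. q \<in> S"
  unfolding orthonormal_frame_def by (blast intro: eventually_nhds_in_open)

lemma frame_orthonormal:
  "orthonormal_frame A k E g S X \<Longrightarrow> p \<in> S \<Longrightarrow> i < k \<Longrightarrow> j < k \<Longrightarrow>
    g p (X i p) (X j p) = (if i = j then 1 else 0)"
  unfolding orthonormal_frame_def by blast

lemma frame_in: "orthonormal_frame A k E g S X \<Longrightarrow> p \<in> S \<Longrightarrow> i < k \<Longrightarrow> X i p \<in> E p"
  using frame_section_near section_near_in by blast

lemma frame_coefficient:
  assumes X: "orthonormal_frame A k E g S X" "p \<in> S" and "j < k"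
  shows "g p (\<Sum>i<k. c i *\<^sub>R X i p) (X j p) = c j"
proof -
  have "g p (\<Sum>i<k. c i *\<^sub>R X i p) (X j p) = (\<Sum>i<k. c i * g p (X i p) (X j p))"
    by (rule metric_combination_left) (use frame_in[OF X] assms(3) in auto)
  also have "\<dots> = (\<Sum>i<k. if i = j then c i else 0)"
    by (intro sum.cong) (use frame_orthonormal[OF X] assms(3) in auto)
  finally show ?thesis using assms(3) by (simp add: sum.delta)
qed

lemma frame_expansion:
  assumes X: "orthonormal_frame A k E g S X" "p \<in> S" and v: "v \<in> E p"
  shows "v = (\<Sum>i<k. g p v (X i p) *\<^sub>R X i p)"
proof -
  have "span ((\<lambda>i. X i p) ` {..<k}) = E p" using X unfolding orthonormal_frame_def by blast
  then obtain c where c: "v = (\<Sum>i<k. c i *\<^sub>R X i p)"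
    using v in_span_image_iff[of "{..<k}" v "\<lambda>i. X i p"] by auto
  have "(\<Sum>i<k. g p v (X i p) *\<^sub>R X i p) = (\<Sum>i<k. c i *\<^sub>R X i p)"
    unfolding c by (intro sum.cong refl) (simp add: frame_coefficient[OF X])
  then show ?thesis using c by simp
qed

lemma coeff_eq_metric:
  assumes X: "orthonormal_frame A k E g S X" "p \<in> S" and v: "V p \<in> E p" and i: "i < k"
  shows "coeff k X V i p = g p (V p) (X i p)"
proof -
  let ?c = "\<lambda>i. if i < k then g p (V p) (X i p) else 0"
  have "(THE c. (\<forall>j\<ge>k. c j = 0) \<and> V p = (\<Sum>j<k. c j *\<^sub>R X j p)) = ?c"
  proof (rule the_equality)
    show "(\<forall>j\<ge>k. ?c j = 0) \<and> V p = (\<Sum>j<k. ?c j *\<^sub>R X j p)"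
      using frame_expansion[OF X v] by simp
  next
    fix c :: "nat \<Rightarrow> real"
    assume c: "(\<forall>j\<ge>k. c j = 0) \<and> V p = (\<Sum>j<k. c j *\<^sub>R X j p)"
    show "c = ?c"
    proof
      fix j
      show "c j = ?c j" using c frame_coefficient[OF X, of j c] by simp
    qed
  qed
  then show ?thesis using i by (simp add: coeff_def)
qed

text \<open>The three derivative terms of the Koszul expression vanish on an orthonormal frame, whose metric
  coefficients are constant; the brackets that remain are those of the Christoffel symbol.\<close>

lemma christoffel_eq_koszul:
  assumes X: "orthonormal_frame A k E g S X" "p \<in> S" and ijl: "i < k" "j < k" "l < k"
  shows "christoffel A E F g X i j l p = 1 / 2 * K (X j) (X i) (X l) p"
proof -
  note s = frame_section_near[OF X] and e = frame_in[OF X]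
  have const: "X a p (\<lambda>q. g q (X b q) (X c q)) = 0" if "a < k" "b < k" "c < k" for a b c
  proof -
    note T = tangent_of_section_near[OF s[OF that(1)]]
    have "X a p (\<lambda>q. g q (X b q) (X c q)) = X a p (\<lambda>q. if b = c then 1 else 0)"
      by (rule tangent_cong[OF T smooth_near_metric[OF s[OF that(2)] s[OF that(3)]]])
        (use frame_eventually[OF X] frame_orthonormal[OF X(1)] that in \<open>auto elim!: eventually_mono\<close>)
    then show ?thesis by (simp add: tangent_const[OF T])
  qed
  have anti: "g p (X a p) (hproj E F (lie_bracket A (X b) (X c)) p) =
      - g p (hproj E F (lie_bracket A (X c) (X b)) p) (X a p)"
    if "a < k" "b < k" "c < k" for a b c
    using br_antisym[OF s[OF that(2)] s[OF that(3)]] e[OF that(1)]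
      br_in[OF s[OF that(3)] s[OF that(2)]] subspace_neg[OF subspace_E]
      metric_scale_left[of "hproj E F (lie_bracket A (X c) (X b)) p" p "X a p" "- 1"]
    by (simp add: metric_sym[of "X a p" p])
  have sym: "g p (X a p) (hproj E F (lie_bracket A (X b) (X c)) p) =
      g p (hproj E F (lie_bracket A (X b) (X c)) p) (X a p)"
    if "a < k" "b < k" "c < k" for a b c
    by (intro metric_sym e br_in s that)
  show ?thesis
    unfolding christoffel_def koszul_def
    using ijl by (simp add: const anti[of j l i] anti[of l i j] sym[of i j l] field_simps)
qed

text \<open>Collecting the terms of the frame connection by the frame field they multiply makes its metric
  products and its smoothness accessible to the rules for single sums.\<close>

definition connection_coefficient ::
  "(nat \<Rightarrow> 'a vfield) \<Rightarrow> 'a vfield \<Rightarrow> 'a vfield \<Rightarrow> nat \<Rightarrow> 'a \<Rightarrow> real" where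
  "connection_coefficient X U V l p = U p (\<lambda>q. g q (V q) (X l q)) +
     (\<Sum>i<k. \<Sum>j<k. g p (U p) (X j p) * g p (V p) (X i p) * (1 / 2 * K (X j) (X i) (X l) p))"

lemma frame_connection_eq:
  assumes X: "orthonormal_frame A k E g S X" "p \<in> S"
    and U: "section_near A E p U" and V: "section_near A E p V"
  shows "frame_connection A k E F g X U V p = (\<Sum>l<k. connection_coefficient X U V l p *\<^sub>R X l p)"
proof -
  have U_coeff: "U p (coeff k X V i) = U p (\<lambda>q. g q (V q) (X i q))" if "i < k" for i
  proof (rule tangent_cong[OF tangent_of_section_near[OF U], symmetric])
    show "smooth_near A p (\<lambda>q. g q (V q) (X i q))"
      by (intro smooth_near_metric V frame_section_near[OF X] that)
    show "\<forall>\<^sub>F q in nhds p. g q (V q) (X i q) = coeff k X V i q"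
      using frame_eventually[OF X] section_near_eventually_in[OF V]
      by eventually_elim (simp add: coeff_eq_metric[OF X(1)] that)
  qed
  let ?a = "\<lambda>i j l. g p (U p) (X j p) * g p (V p) (X i p) * (1 / 2 * K (X j) (X i) (X l) p)"
  have "frame_connection A k E F g X U V p = (\<Sum>i<k. U p (\<lambda>q. g q (V q) (X i q)) *\<^sub>R X i p) +
      (\<Sum>i<k. \<Sum>j<k. \<Sum>l<k. ?a i j l *\<^sub>R X l p)"
    unfolding frame_connection_def
    by (intro arg_cong2[where f = plus] sum.cong refl)
      (use section_near_in[OF U] section_near_in[OF V] in
        \<open>auto simp: U_coeff coeff_eq_metric[OF X] christoffel_eq_koszul[OF X]\<close>)
  also have "\<dots> = (\<Sum>l<k. U p (\<lambda>q. g q (V q) (X l q)) *\<^sub>R X l p) +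
      (\<Sum>l<k. (\<Sum>i<k. \<Sum>j<k. ?a i j l) *\<^sub>R X l p)"
    by (subst sum_rotate) (simp only: scaleR_sum_left)
  also have "\<dots> = (\<Sum>l<k. connection_coefficient X U V l p *\<^sub>R X l p)"
    unfolding connection_coefficient_def by (simp only: scaleR_left_distrib sum.distrib)
  finally show ?thesis .
qed

lemma smooth_near_connection_coefficient:
  assumes X: "orthonormal_frame A k E g S X" "p \<in> S" and "l < k"
    and U: "section_near A E p U" and V: "section_near A E p V"
  shows "smooth_near A p (connection_coefficient X U V l)"
  unfolding connection_coefficient_def
  by (intro smooth_near_add smooth_near_sum smooth_near_mult smooth_near_const section_near_smooth[OF U]
      smooth_near_metric smooth_near_koszul frame_section_near[OF X] U V) (use assms(3) in auto)

lemma section_near_frame_connection: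
  assumes X: "orthonormal_frame A k E g S X" "p \<in> S"
    and U: "section_near A E p U" and V: "section_near A E p V"
  shows "section_near A E p (frame_connection A k E F g X U V)"
proof (rule section_near_cong)
  show "section_near A E p (\<Sum>l<k. fun_scale (connection_coefficient X U V l) (X l))"
    by (intro section_near_combination smooth_near_connection_coefficient[OF X]
        frame_section_near[OF X] U V)
  show "\<forall>\<^sub>F q in nhds p. (\<Sum>l<k. fun_scale (connection_coefficient X U V l) (X l)) q =
      frame_connection A k E F g X U V q"
    using frame_eventually[OF X] eventually_section_near[OF U] eventually_section_near[OF V]
    by eventually_elim (simp add: frame_connection_eq[OF X(1)] sum_fun_apply fun_scale_def)
qed

lemma section_expansion_near:
  assumes X: "orthonormal_frame A k E g S X" "p \<in> S" and U: "section_near A E p U"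
  shows "\<forall>\<^sub>F q in nhds p. U q = (\<Sum>j<k. fun_scale (\<lambda>q. g q (U q) (X j q)) (X j)) q"
  using frame_eventually[OF X] section_near_eventually_in[OF U]
proof eventually_elim
  case (elim q)
  have "(\<Sum>j<k. fun_scale (\<lambda>q. g q (U q) (X j q)) (X j)) q = (\<Sum>j<k. g q (U q) (X j q) *\<^sub>R X j q)"
    by (simp only: sum_fun_apply fun_scale_def)
  then show ?case using frame_expansion[OF X(1) elim] by simp
qed

text \<open>Expanding \<open>U\<close>, \<open>V\<close> and \<open>W\<close> in the frame, linearity over functions reduces the Koszul expression to
  its values on frame fields. The slot of \<open>V\<close> obeys a Leibniz rule instead, and its extra terms are the
  derivatives of the coefficients of \<open>V\<close> in the definition of the frame connection.\<close>

lemma frame_connection_koszul: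
  assumes X: "orthonormal_frame A k E g S X" "p \<in> S"
    and U: "section_near A E p U" and V: "section_near A E p V" and W: "section_near A E p W"
  shows "2 * g p (frame_connection A k E F g X U V p) (W p) = K U V W p"
proof -
  note s = frame_section_near[OF X] and e = frame_in[OF X]
  define u where "u j q = g q (U q) (X j q)" for j q
  define v where "v i q = g q (V q) (X i q)" for i q
  define w where "w l q = g q (W q) (X l q)" for l q
  have smooth: "smooth_near A p (u i)" "smooth_near A p (v i)" "smooth_near A p (w i)" if "i < k" for i
    unfolding u_def v_def w_def by (intro smooth_near_metric U V W s that)+
  have Uq: "\<forall>\<^sub>F q in nhds p. U q = (\<Sum>j<k. fun_scale (u j) (X j)) q"
    and Vq: "\<forall>\<^sub>F q in nhds p. V q = (\<Sum>i<k. fun_scale (v i) (X i)) q"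
    and Wq: "\<forall>\<^sub>F q in nhds p. W q = (\<Sum>l<k. fun_scale (w l) (X l)) q"
    unfolding u_def v_def w_def by (intro section_expansion_near[OF X] U V W)+
  have same: "\<forall>\<^sub>F q in nhds p. Y q = Y q" for Y :: "'a vfield" by simp
  have "K U V W p = K (\<Sum>j<k. fun_scale (u j) (X j)) V W p"
    by (rule koszul_cong[OF U V W Uq same same])
  also have "\<dots> = (\<Sum>j<k. u j p * K (X j) V W p)"
    by (rule koszul_combination(1)[OF smooth(1) s V W])
  also have "\<dots> = (\<Sum>j<k. u j p * (\<Sum>i<k. v i p * (\<Sum>l<k. w l p * K (X j) (X i) (X l) p) +
      2 * (X j p (v i) * w i p)))"
  proof (intro sum.cong refl arg_cong2[where f = times])
    fix j
    assume "j \<in> {..<k}"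
    then have j: "j < k" by simp
    have "K (X j) V W p = K (X j) (\<Sum>i<k. fun_scale (v i) (X i)) W p"
      by (rule koszul_cong[OF s[OF j] V W same Vq same])
    also have "\<dots> = (\<Sum>i<k. v i p * K (X j) (X i) W p + 2 * (X j p (v i) * g p (X i p) (W p)))"
      by (rule koszul_combination(2)[OF smooth(2) s s[OF j] W])
    also have "\<dots> = (\<Sum>i<k. v i p * (\<Sum>l<k. w l p * K (X j) (X i) (X l) p) +
        2 * (X j p (v i) * w i p))"
    proof (rule sum.cong[OF refl])
      fix i
      assume "i \<in> {..<k}"
      then have i: "i < k" by simp
      have "K (X j) (X i) W p = K (X j) (X i) (\<Sum>l<k. fun_scale (w l) (X l)) p"
        by (rule koszul_cong[OF s[OF j] s[OF i] W same same Wq])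
      also have "\<dots> = (\<Sum>l<k. w l p * K (X j) (X i) (X l) p)"
        by (rule koszul_combination(3)[OF smooth(3) s s[OF j] s[OF i]])
      finally show "v i p * K (X j) (X i) W p + 2 * (X j p (v i) * g p (X i p) (W p)) =
          v i p * (\<Sum>l<k. w l p * K (X j) (X i) (X l) p) + 2 * (X j p (v i) * w i p)"
        using metric_sym[OF e[OF i] section_near_in[OF W]] by (simp add: w_def)
    qed
    finally show "K (X j) V W p = (\<Sum>i<k. v i p * (\<Sum>l<k. w l p * K (X j) (X i) (X l) p) +
        2 * (X j p (v i) * w i p))" .
  qed
  also have "\<dots> = (\<Sum>j<k. \<Sum>i<k. \<Sum>l<k. u j p * v i p * K (X j) (X i) (X l) p * w l p) +
      (\<Sum>j<k. \<Sum>i<k. 2 * (u j p * X j p (v i)) * w i p)"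
    by (simp add: sum_distrib_left distrib_left sum.distrib mult_ac)
  also have "(\<Sum>j<k. \<Sum>i<k. 2 * (u j p * X j p (v i)) * w i p) = (\<Sum>i<k. 2 * U p (v i) * w i p)"
  proof -
    have "U p (v i) = (\<Sum>j<k. u j p * X j p (v i))" for i
    proof -
      have "U p = (\<Sum>j<k. u j p *\<^sub>R X j p)"
        unfolding u_def by (rule frame_expansion[OF X section_near_in[OF U]])
      then have "U p (v i) = (\<Sum>j<k. u j p *\<^sub>R X j p) (v i)" by (rule fun_cong)
      then show ?thesis by (simp only: sum_scaleR_apply)
    qed
    then have "(\<Sum>i<k. 2 * U p (v i) * w i p) = (\<Sum>i<k. \<Sum>j<k. 2 * (u j p * X j p (v i)) * w i p)"
      by (simp add: sum_distrib_left sum_distrib_right)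
    also have "\<dots> = (\<Sum>j<k. \<Sum>i<k. 2 * (u j p * X j p (v i)) * w i p)" by (rule sum.swap)
    finally show ?thesis by (rule sym)
  qed
  also have "(\<Sum>j<k. \<Sum>i<k. \<Sum>l<k. u j p * v i p * K (X j) (X i) (X l) p * w l p) =
      (\<Sum>l<k. \<Sum>i<k. \<Sum>j<k. u j p * v i p * K (X j) (X i) (X l) p * w l p)"
    by (subst sum_rotate) (intro sum.cong refl sum.swap)
  also have "(\<Sum>l<k. \<Sum>i<k. \<Sum>j<k. u j p * v i p * K (X j) (X i) (X l) p * w l p) +
      (\<Sum>i<k. 2 * U p (v i) * w i p) = (\<Sum>l<k. 2 * (connection_coefficient X U V l p * w l p))"
    unfolding connection_coefficient_def u_def[symmetric] v_def[symmetric] sum.distrib[symmetric]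
    by (intro sum.cong refl)
      (simp add: sum_distrib_left sum_distrib_right distrib_left distrib_right mult_ac)
  also have "\<dots> = 2 * (\<Sum>l<k. connection_coefficient X U V l p * g p (X l p) (W p))"
    unfolding sum_distrib_left w_def
    by (intro sum.cong refl) (use metric_sym e section_near_in[OF W] in auto)
  also have "(\<Sum>l<k. connection_coefficient X U V l p * g p (X l p) (W p)) =
      g p (frame_connection A k E F g X U V p) (W p)"
    unfolding frame_connection_eq[OF X U V]
    by (rule metric_combination_left[symmetric]) (use e section_near_in[OF W] in auto)
  finally show ?thesis by (rule sym)
qed

end


section \<open>The connection on global sections\<close>

context sub_riemannian_splitting
begin

text \<open>Gram-Schmidt for a local frame of the distribution, on a neighbourhood where all germ conditions hold.\<close>

lemma orthonormal_frame_at: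
  obtains S X where "orthonormal_frame A k E g S X" "p \<in> S"
proof -
  obtain X where X: "\<And>i. i < k \<Longrightarrow> section_near A E p (X i)"
    "\<forall>\<^sub>F q in nhds p. independent_family k (\<lambda>i. X i q) \<and> span ((\<lambda>i. X i q) ` {..<k}) = E q"
    by (rule distribution_frame_near[OF distribution_E, of p]) blast
  have "\<forall>\<^sub>F q in nhds p. independent_family k (\<lambda>i. X i q)"
    using X(2) by eventually_elim blast
  then obtain Y where Y: "orthonormal_near k p Y"
    and span: "\<forall>\<^sub>F q in nhds p. span ((\<lambda>i. Y i q) ` {..<k}) = span ((\<lambda>i. X i q) ` {..<k})"
    using gram_schmidt[of k p X] X(1) by blast
  have "\<forall>\<^sub>F q in nhds p. \<forall>i\<in>{..<k}. section_near A E q (Y i)"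
    using Y unfolding orthonormal_near_def
    by (intro eventually_ball_finite) (auto intro: eventually_section_near)
  moreover have "\<forall>\<^sub>F q in nhds p. \<forall>i<k. \<forall>j<k. g q (Y i q) (Y j q) = (if i = j then 1 else 0)"
    using Y unfolding orthonormal_near_def by blast
  ultimately have "\<forall>\<^sub>F q in nhds p. (\<forall>i\<in>{..<k}. section_near A E q (Y i)) \<and>
      span ((\<lambda>i. Y i q) ` {..<k}) = E q \<and>
      (\<forall>i<k. \<forall>j<k. g q (Y i q) (Y j q) = (if i = j then 1 else 0))"
    using X(2) span by eventually_elim simp
  then obtain S where S: "open S" "p \<in> S"
    "\<And>q. q \<in> S \<Longrightarrow> (\<forall>i\<in>{..<k}. section_near A E q (Y i)) \<and> span ((\<lambda>i. Y i q) ` {..<k}) = E q \<and>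
      (\<forall>i<k. \<forall>j<k. g q (Y i q) (Y j q) = (if i = j then 1 else 0))"
    unfolding eventually_nhds by blast
  have "Y i \<in> sections A E S" if "i < k" for i
    unfolding sections_iff_near[OF S(1)] using S(3) that by blast
  then have "orthonormal_frame A k E g S Y"
    unfolding orthonormal_frame_def using S by blast
  then show thesis using S(2) by (rule that)
qed

lemma global_section_near: "X \<in> \<Gamma> A E \<Longrightarrow> section_near A E p X"
  by (simp add: sections_iff_near)

lemma global_sectionI: "(\<And>p. section_near A E p X) \<Longrightarrow> X \<in> \<Gamma> A E"
  by (simp add: sections_iff_near)

lemma global_section_with_value:
  assumes "w \<in> E p"
  obtains W where "W \<in> \<Gamma> A E" "W p = w"
proof -
  obtain S X where X: "orthonormal_frame A k E g S X" "p \<in> S" by (rule orthonormal_frame_at)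
  define V where "V = (\<Sum>i<k. fun_scale (\<lambda>q. g p w (X i p)) (X i))"
  have V: "section_near A E p V"
    unfolding V_def by (intro section_near_combination smooth_near_const frame_section_near[OF X])
  obtain W where "W \<in> \<Gamma> A E" "W p = V p"
    using subspace_E V by (rule global_section_through)
  moreover have "V p = w"
    using frame_expansion[OF X assms] sum_fun_apply[of "\<lambda>i. fun_scale (\<lambda>q. g p w (X i p)) (X i)"]
    by (simp add: V_def fun_scale_def)
  ultimately show thesis using that by simp
qed

lemma eqI_global_sections:
  assumes "u \<in> E p" "v \<in> E p" "\<And>W. W \<in> \<Gamma> A E \<Longrightarrow> 2 * g p u (W p) = 2 * g p v (W p)"
  shows "u = v"
proof (rule metric_eqI[OF assms(1,2)])
  fix w
  assume "w \<in> E p"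
  then obtain W where "W \<in> \<Gamma> A E" "W p = w" by (rule global_section_with_value)
  then show "g p u w = g p v w" using assms(3)[of W] by simp
qed

text \<open>The Koszul expression does not mention the frame.\<close>

lemma frame_connection_unique:
  assumes "orthonormal_frame A k E g S X" "p \<in> S" "orthonormal_frame A k E g S' X'" "p \<in> S'"
    and "U \<in> \<Gamma> A E" "V \<in> \<Gamma> A E"
  shows "frame_connection A k E F g X U V p = frame_connection A k E F g X' U V p"
proof -
  note s = assms(5,6)[THEN global_section_near]
  show ?thesis
  proof (rule eqI_global_sections)
    fix W
    assume "W \<in> \<Gamma> A E"
    then have W: "section_near A E p W" by (rule global_section_near)
    show "2 * g p (frame_connection A k E F g X U V p) (W p) =
        2 * g p (frame_connection A k E F g X' U V p) (W p)"
      unfolding frame_connection_koszul[OF assms(1,2) s W] frame_connection_koszul[OF assms(3,4) s W] ..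
  qed (rule section_near_in, rule section_near_frame_connection, rule assms, rule assms, rule s, rule s)+
qed

lemma ex1_frame_connection:
  assumes "U \<in> \<Gamma> A E" "V \<in> \<Gamma> A E"
  shows "\<exists>!w. \<exists>S X. orthonormal_frame A k E g S X \<and> p \<in> S \<and> w = frame_connection A k E F g X U V p"
proof -
  obtain S X where X: "orthonormal_frame A k E g S X" "p \<in> S" by (rule orthonormal_frame_at)
  show ?thesis
  proof (rule ex1I)
    show "\<exists>S' X'. orthonormal_frame A k E g S' X' \<and> p \<in> S' \<and>
        frame_connection A k E F g X U V p = frame_connection A k E F g X' U V p"
      using X by blast
  qed (use frame_connection_unique[OF _ _ X assms] in blast)
qed

abbreviation "D \<equiv> sr_connection A k E F g"

lemma sr_connection_eq:
  assumes "orthonormal_frame A k E g S X" "p \<in> S" "U \<in> \<Gamma> A E" "V \<in> \<Gamma> A E"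
  shows "D U V p = frame_connection A k E F g X U V p"
  unfolding sr_connection_def
  by (rule the1_equality[OF ex1_frame_connection[OF assms(3,4)]]) (use assms(1,2) in blast)

lemma sr_connection_section:
  assumes "U \<in> \<Gamma> A E" "V \<in> \<Gamma> A E"
  shows "D U V \<in> \<Gamma> A E"
proof (rule global_sectionI)
  fix p
  obtain S X where X: "orthonormal_frame A k E g S X" "p \<in> S" by (rule orthonormal_frame_at)
  show "section_near A E p (D U V)"
  proof (rule section_near_cong)
    show "section_near A E p (frame_connection A k E F g X U V)"
      by (intro section_near_frame_connection[OF X] global_section_near assms)
    show "\<forall>\<^sub>F q in nhds p. frame_connection A k E F g X U V q = D U V q"
      using frame_eventually[OF X] by eventually_elim (simp add: sr_connection_eq[OF X(1)] assms)
  qed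
qed

lemma sr_connection_koszul:
  assumes "U \<in> \<Gamma> A E" "V \<in> \<Gamma> A E" "W \<in> \<Gamma> A E"
  shows "2 * g p (D U V p) (W p) = K U V W p"
proof -
  obtain S X where X: "orthonormal_frame A k E g S X" "p \<in> S" by (rule orthonormal_frame_at)
  show ?thesis
    unfolding sr_connection_eq[OF X assms(1,2)]
    by (intro frame_connection_koszul[OF X] global_section_near assms)
qed

text \<open>The properties of \<open>D\<close> are read off from those of the Koszul expression by this criterion.\<close>

lemma sr_connection_eqI:
  assumes "U \<in> \<Gamma> A E" "V \<in> \<Gamma> A E" "Y \<in> \<Gamma> A E"
    and "\<And>W p. W \<in> \<Gamma> A E \<Longrightarrow> 2 * g p (Y p) (W p) = K U V W p"
  shows "D U V = Y"
proof
  fix p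
  show "D U V p = Y p"
  proof (rule eqI_global_sections)
    show "D U V p \<in> E p" by (rule global_section_in[OF sr_connection_section[OF assms(1,2)]])
    show "Y p \<in> E p" by (rule global_section_in[OF assms(3)])
    show "2 * g p (D U V p) (W p) = 2 * g p (Y p) (W p)" if "W \<in> \<Gamma> A E" for W
      unfolding sr_connection_koszul[OF assms(1,2) that] assms(4)[OF that] ..
  qed
qed

lemma smooth_near_global: "smooth_fun_on A UNIV f \<Longrightarrow> smooth_near A p f"
  by (simp add: smooth_fun_on_iff_near)

lemma global_section_add: "X \<in> \<Gamma> A E \<Longrightarrow> Y \<in> \<Gamma> A E \<Longrightarrow> X + Y \<in> \<Gamma> A E"
  by (rule global_sectionI) (intro section_near_add subspace_E global_section_near)

lemma global_section_fun_scale: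
  "smooth_fun_on A UNIV f \<Longrightarrow> X \<in> \<Gamma> A E \<Longrightarrow> fun_scale f X \<in> \<Gamma> A E"
  by (rule global_sectionI)
    (intro section_near_fun_scale subspace_E global_section_near smooth_near_global)

lemma smooth_derivative_global:
  assumes "smooth_fun_on A UNIV f" "U \<in> \<Gamma> A E"
  shows "smooth_fun_on A UNIV (\<lambda>p. U p f)"
  unfolding smooth_fun_on_iff_near[OF open_UNIV]
  by (intro ballI section_near_smooth[OF global_section_near[OF assms(2)]] smooth_near_global assms(1))

lemma sr_connection_add_left:
  assumes UV: "U \<in> \<Gamma> A E" "U' \<in> \<Gamma> A E" "V \<in> \<Gamma> A E"
  shows "D (U + U') V = D U V + D U' V"
proof (rule sr_connection_eqI)
  fix W p
  assume W: "W \<in> \<Gamma> A E"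
  note D = sr_connection_section[OF UV(1,3)] sr_connection_section[OF UV(2,3)]
  have "g p (D U V p + D U' V p) (W p) = g p (D U V p) (W p) + g p (D U' V p) (W p)"
    by (rule metric_add_left[OF D[THEN global_section_in] global_section_in[OF W]])
  moreover have "K (U + U') V W p = K U V W p + K U' V W p"
    by (intro koszul_add_1 global_section_near UV W)
  ultimately show "2 * g p ((D U V + D U' V) p) (W p) = K (U + U') V W p"
    using sr_connection_koszul[OF UV(1,3) W, of p] sr_connection_koszul[OF UV(2,3) W, of p] by simp
qed (intro global_section_add sr_connection_section UV)+

lemma sr_connection_add_right:
  assumes UV: "U \<in> \<Gamma> A E" "V \<in> \<Gamma> A E" "V' \<in> \<Gamma> A E"
  shows "D U (V + V') = D U V + D U V'"
proof (rule sr_connection_eqI)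
  fix W p
  assume W: "W \<in> \<Gamma> A E"
  note D = sr_connection_section[OF UV(1,2)] sr_connection_section[OF UV(1,3)]
  have "g p (D U V p + D U V' p) (W p) = g p (D U V p) (W p) + g p (D U V' p) (W p)"
    by (rule metric_add_left[OF D[THEN global_section_in] global_section_in[OF W]])
  moreover have "K U (V + V') W p = K U V W p + K U V' W p"
    by (intro koszul_add_2 global_section_near UV W)
  ultimately show "2 * g p ((D U V + D U V') p) (W p) = K U (V + V') W p"
    using sr_connection_koszul[OF UV(1,2) W, of p] sr_connection_koszul[OF UV(1,3) W, of p] by simp
qed (intro global_section_add sr_connection_section UV)+

lemma sr_connection_fun_scale_left:
  assumes f: "smooth_fun_on A UNIV f" and UV: "U \<in> \<Gamma> A E" "V \<in> \<Gamma> A E"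
  shows "D (fun_scale f U) V = fun_scale f (D U V)"
proof (rule sr_connection_eqI)
  fix W p
  assume W: "W \<in> \<Gamma> A E"
  have "g p (f p *\<^sub>R D U V p) (W p) = f p * g p (D U V p) (W p)"
    by (rule metric_scale_left[OF sr_connection_section[OF UV, THEN global_section_in]
          global_section_in[OF W]])
  moreover have "K (fun_scale f U) V W p = f p * K U V W p"
    by (intro koszul_fun_scale_1 smooth_near_global global_section_near f UV W)
  ultimately show "2 * g p (fun_scale f (D U V) p) (W p) = K (fun_scale f U) V W p"
    using sr_connection_koszul[OF UV W, of p] by (simp add: fun_scale_def)
qed (intro global_section_fun_scale sr_connection_section f UV)+

lemma sr_connection_leibniz:
  assumes f: "smooth_fun_on A UNIV f" and UV: "U \<in> \<Gamma> A E" "V \<in> \<Gamma> A E"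
  shows "D U (fun_scale f V) = fun_scale (\<lambda>p. U p f) V + fun_scale f (D U V)"
proof (rule sr_connection_eqI)
  fix W p
  assume W: "W \<in> \<Gamma> A E"
  note E = sr_connection_section[OF UV, THEN global_section_in, of p]
    global_section_in[OF UV(2), of p] global_section_in[OF W, of p]
  have "g p (U p f *\<^sub>R V p + f p *\<^sub>R D U V p) (W p) = g p (U p f *\<^sub>R V p) (W p) + g p (f p *\<^sub>R D U V p) (W p)"
    by (intro metric_add_left subspace_scale[OF subspace_E] E)
  moreover have "g p (U p f *\<^sub>R V p) (W p) = U p f * g p (V p) (W p)"
    by (intro metric_scale_left E)
  moreover have "g p (f p *\<^sub>R D U V p) (W p) = f p * g p (D U V p) (W p)"
    by (intro metric_scale_left E)
  moreover have "K U (fun_scale f V) W p = f p * K U V W p + 2 * (U p f * g p (V p) (W p))"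
    by (intro koszul_fun_scale_2 smooth_near_global global_section_near f UV W)
  ultimately show "2 * g p ((fun_scale (\<lambda>p. U p f) V + fun_scale f (D U V)) p) (W p) =
      K U (fun_scale f V) W p"
    using sr_connection_koszul[OF UV W, of p] by (simp add: fun_scale_def)
next
  note sections = global_section_fun_scale[OF f UV(2)]
    global_section_fun_scale[OF smooth_derivative_global[OF f UV(1)] UV(2)]
    global_section_fun_scale[OF f sr_connection_section[OF UV]]
  show "U \<in> \<Gamma> A E" "fun_scale f V \<in> \<Gamma> A E"
    "fun_scale (\<lambda>p. U p f) V + fun_scale f (D U V) \<in> \<Gamma> A E"
    by (rule UV(1), rule sections(1), rule global_section_add[OF sections(2,3)])
qed

lemma sr_connection_metric:
  assumes UVW: "U \<in> \<Gamma> A E" "V \<in> \<Gamma> A E" "W \<in> \<Gamma> A E"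
  shows "U p (\<lambda>q. g q (V q) (W q)) = g p (D U V p) (W p) + g p (V p) (D U W p)"
proof -
  have "g p (V p) (D U W p) = g p (D U W p) (V p)"
    by (rule metric_sym[OF global_section_in[OF UVW(2)]
          global_section_in[OF sr_connection_section[OF UVW(1,3)]]])
  moreover have "K U V W p + K U W V p = 2 * U p (\<lambda>q. g q (V q) (W q))"
    by (intro koszul_metric global_section_near UVW)
  ultimately show ?thesis
    using sr_connection_koszul[OF UVW, of p] sr_connection_koszul[OF UVW(1,3,2), of p] by simp
qed

lemma sr_connection_torsion:
  assumes UV: "U \<in> \<Gamma> A E" "V \<in> \<Gamma> A E"
  shows "D U V - D V U = hproj E F (lie_bracket A U V)"
proof
  fix p
  note D = sr_connection_section[OF UV, THEN global_section_in, of p]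
    sr_connection_section[OF UV(2,1), THEN global_section_in, of p]
  show "(D U V - D V U) p = hproj E F (lie_bracket A U V) p"
  proof (rule eqI_global_sections)
    show "(D U V - D V U) p \<in> E p" using subspace_diff[OF subspace_E D] by simp
    show "hproj E F (lie_bracket A U V) p \<in> E p" by (intro br_in global_section_near UV)
    fix W
    assume W: "W \<in> \<Gamma> A E"
    have "K U V W p - K V U W p = 2 * g p (hproj E F (lie_bracket A U V) p) (W p)"
      by (intro koszul_torsion global_section_near UV W)
    then show "2 * g p ((D U V - D V U) p) (W p) = 2 * g p (hproj E F (lie_bracket A U V) p) (W p)"
      using sr_connection_koszul[OF UV W, of p] sr_connection_koszul[OF UV(2,1) W, of p]
        metric_diff_left[OF D global_section_in[OF W]] by simp
  qed
qed

lemma metric_torsion_free_sr_connection: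
  "metric_torsion_free_connection A E g (\<lambda>U V. hproj E F (lie_bracket A U V)) D"
proof -
  have const: "smooth_fun_on A UNIV (\<lambda>p. c)" for c
    by (simp add: smooth_fun_on_iff_near smooth_near_const)
  have scaleR_eq: "c *\<^sub>R X = fun_scale (\<lambda>p. c) X" for c and X :: "'a vfield"
    by (simp add: fun_scale_def scaleR_fun_def)
  have scale_right: "D U (c *\<^sub>R V) = c *\<^sub>R D U V" if U: "U \<in> \<Gamma> A E" and V: "V \<in> \<Gamma> A E" for c U V
  proof -
    have "fun_scale (\<lambda>p. U p (\<lambda>q. c)) V = 0"
      by (rule ext)
        (simp add: fun_scale_def tangent_const[OF tangent_of_section_near[OF global_section_near[OF U]]])
    then show ?thesis unfolding scaleR_eq sr_connection_leibniz[OF const U V] by simp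
  qed
  have scale_left: "D (c *\<^sub>R U) V = c *\<^sub>R D U V" if U: "U \<in> \<Gamma> A E" and V: "V \<in> \<Gamma> A E" for c U V
    unfolding scaleR_eq by (rule sr_connection_fun_scale_left[OF const U V])
  show ?thesis
    unfolding metric_torsion_free_connection_def
    by (intro conjI allI ballI impI sr_connection_section sr_connection_add_left scale_left
        sr_connection_add_right scale_right sr_connection_fun_scale_left sr_connection_leibniz
        sr_connection_metric sr_connection_torsion; assumption)
qed

lemma sr_connection_unique:
  assumes D': "metric_torsion_free_connection A E g (\<lambda>U V. hproj E F (lie_bracket A U V)) D'"
    and UV: "U \<in> \<Gamma> A E" "V \<in> \<Gamma> A E"
  shows "D' U V = D U V"
proof (rule sr_connection_eqI[OF UV, symmetric])
  show "D' U V \<in> \<Gamma> A E"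
    using D'[unfolded metric_torsion_free_connection_def, THEN conjunct1] UV by blast
qed (rule koszul_identity[OF D' UV])

text \<open>On sections of \<open>E\<close> the Koszul expression of the extended metric with the full bracket equals the one
  of \<open>g\<close> with the projected bracket: the component of a bracket in \<open>F\<close> is orthogonal to \<open>E\<close>. So the
  Levi-Civita connection and \<open>D\<close> have the same inner products with \<open>E\<close>.\<close>

lemma levi_civita_horizontal:
  assumes g': "orthogonal_extension A E F g g'" and nabla: "levi_civita A g' nabla"
    and X: "orthonormal_frame A k E g S X" "p \<in> S" and UV: "U \<in> \<Gamma> A E" "V \<in> \<Gamma> A E"
  shows "D U V p = horizontal_connection k g' nabla X U V p"
proof -
  have metric': "fiber_metric A (tangent_space A) g'"
    and restrict: "\<And>q u v. u \<in> E q \<Longrightarrow> v \<in> E q \<Longrightarrow> g' q u v = g q u v"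
    and orth: "\<And>q u w. u \<in> E q \<Longrightarrow> w \<in> F q \<Longrightarrow> g' q u w = 0"
    using g' unfolding orthogonal_extension_def by simp_all
  interpret TM: metric_bundle A "tangent_space A" g'
    by standard (rule subspace_tangent_space, rule metric')
  have T: "Y \<in> \<Gamma> A (tangent_space A)" if "Y \<in> \<Gamma> A E" for Y
    using that section_near_tangent by (auto simp: sections_iff_near)
  have F_tangent: "w \<in> tangent_space A q" if "w \<in> F q" for w q
  proof -
    have "w = 0 + w" by simp
    then show ?thesis unfolding sum_E_F[symmetric] using that subspace_0[OF subspace_E] by blast
  qed
  have bracket: "g' p (lie_bracket A Y Z p) (W p) = g p (hproj E F (lie_bracket A Y Z) p) (W p)"
    if "Y \<in> \<Gamma> A E" "Z \<in> \<Gamma> A E" "W \<in> \<Gamma> A E" for Y Z W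
  proof -
    have t: "lie_bracket A Y Z p \<in> tangent_space A p"
      using that(1,2)[THEN global_section_near, THEN section_near_tangent]
      by (rule lie_bracket_tangent)
    obtain w where w: "hproj E F (lie_bracket A Y Z) p \<in> E p" "w \<in> F p"
      "lie_bracket A Y Z p = hproj E F (lie_bracket A Y Z) p + w"
      using t by (rule hproj_decomposition)
    note W = global_section_in[OF that(3), of p]
    have "g' p (lie_bracket A Y Z p) (W p) = g' p (hproj E F (lie_bracket A Y Z) p) (W p) + g' p w (W p)"
      unfolding w(3) by (intro TM.metric_add_left E_tangent F_tangent w W)
    also have "g' p w (W p) = 0"
      using orth[OF W w(2)] TM.metric_sym[OF F_tangent[OF w(2)] E_tangent[OF W]] by simp
    finally show ?thesis using restrict[OF w(1) W] by simp
  qed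
  have eq: "g' p (nabla U V p) (X i p) = g p (D U V p) (X i p)" if i: "i < k" for i
  proof -
    obtain W where W: "W \<in> \<Gamma> A E" "W p = X i p"
      using frame_in[OF X i] by (rule global_section_with_value)
    have restrict_fun: "(\<lambda>q. g' q (Y q) (Z q)) = (\<lambda>q. g q (Y q) (Z q))"
      if "Y \<in> \<Gamma> A E" "Z \<in> \<Gamma> A E" for Y Z
      using restrict global_section_in that by blast
    have "2 * g' p (nabla U V p) (W p) = koszul g' (lie_bracket A) U V W p"
      using nabla unfolding levi_civita_def by (rule TM.koszul_identity) (intro T UV W(1))+
    also have "\<dots> = K U V W p"
      unfolding koszul_def using UV W(1) by (simp add: restrict_fun bracket)
    also have "\<dots> = 2 * g p (D U V p) (W p)" by (rule sr_connection_koszul[OF UV W(1), symmetric])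
    finally show ?thesis using W(2) by simp
  qed
  have "D U V p = (\<Sum>i<k. g p (D U V p) (X i p) *\<^sub>R X i p)"
    by (intro frame_expansion[OF X] global_section_in sr_connection_section UV)
  also have "\<dots> = horizontal_connection k g' nabla X U V p"
    unfolding horizontal_connection_def by (intro sum.cong refl) (simp add: eq)
  finally show ?thesis .
qed

end

theorem theorem1p2:
  fixes A :: "('a::{t2_space, second_countable_topology}, 'e::euclidean_space) atlas"
    and k :: nat
    and \<Delta> \<Delta>' :: "'a \<Rightarrow> 'a tvec set"
    and gc :: "'a \<Rightarrow> 'a tvec \<Rightarrow> 'a tvec \<Rightarrow> real"
  assumes "sub_riemannian A k \<Delta> gc"
    and "distribution A (DIM('e) - k) \<Delta>'"
    and "complementary A \<Delta> \<Delta>'"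
  defines "D \<equiv> sr_connection A k \<Delta> \<Delta>' gc"
    and "brH \<equiv> \<lambda>U V. hproj \<Delta> \<Delta>' (lie_bracket A U V)"
  shows
    "(\<forall>U\<in>\<Gamma> A \<Delta>. \<forall>V\<in>\<Gamma> A \<Delta>. \<forall>p. \<exists>!w. \<exists>S X. orthonormal_frame A k \<Delta> gc S X \<and> p \<in> S \<and>
        w = frame_connection A k \<Delta> \<Delta>' gc X U V p) \<and>
     (\<forall>S X. orthonormal_frame A k \<Delta> gc S X \<longrightarrow> (\<forall>U\<in>\<Gamma> A \<Delta>. \<forall>V\<in>\<Gamma> A \<Delta>. \<forall>p\<in>S.
        D U V p = frame_connection A k \<Delta> \<Delta>' gc X U V p)) \<and>
     metric_torsion_free_connection A \<Delta> gc brH D \<and>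
     (\<forall>D'. metric_torsion_free_connection A \<Delta> gc brH D' \<longrightarrow>
        (\<forall>U\<in>\<Gamma> A \<Delta>. \<forall>V\<in>\<Gamma> A \<Delta>. D' U V = D U V)) \<and>
     (\<forall>g nabla. orthogonal_extension A \<Delta> \<Delta>' gc g \<longrightarrow> levi_civita A g nabla \<longrightarrow>
        (\<forall>S X. orthonormal_frame A k \<Delta> gc S X \<longrightarrow> (\<forall>U\<in>\<Gamma> A \<Delta>. \<forall>V\<in>\<Gamma> A \<Delta>. \<forall>p\<in>S.
           D U V p = horizontal_connection k g nabla X U V p)))"
proof -
  interpret M: sub_riemannian_splitting A k "DIM('e) - k" \<Delta> \<Delta>' gc
    using assms(1-3) unfolding sub_riemannian_def by unfold_locales auto
  show ?thesis
    unfolding D_def brH_def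
  proof (intro conjI allI ballI impI)
    fix U V p
    assume "U \<in> \<Gamma> A \<Delta>" "V \<in> \<Gamma> A \<Delta>"
    then show "\<exists>!w. \<exists>S X. orthonormal_frame A k \<Delta> gc S X \<and> p \<in> S \<and>
        w = frame_connection A k \<Delta> \<Delta>' gc X U V p"
      by (rule M.ex1_frame_connection)
  qed (rule M.sr_connection_eq M.metric_torsion_free_sr_connection M.sr_connection_unique
      M.levi_civita_horizontal; assumption)+
qed

end
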